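(* Let $(\Omega,\mathcal F)$ be a measurable space and $\mathfrak P\subset\Delta(\mathcal F)$ nonempty. Suppose $\mathfrak P$ is of class (S) with supported alternative $\mathfrak Q$, and that an enlargement $(\mathcal G,\widehat{\mathfrak P})$ completes $L^\infty_{\mathbf c}$. Let $\widehat{\mathbf c}$ denote the upper probability associated with $\widehat{\mathfrak P}$ on $\mathcal G$. Then the following assertions hold: (1) Each $\mu\in sca_{\mathbf c}$ extends uniquely to a $\widehat\mu\in sca_{\widehat{\mathbf c}}$. (2) Each supported alternative $\mathfrak Q\approx\mathfrak P$ extends to a supported alternative $\widehat{\mathfrak Q}:=\{\widehat{\mathbb Q}\mid\mathbb Q\in\mathfrak Q\}\approx\widehat{\mathfrak P}$. (3) One may assume $\mathcal G=\mathcal G(\widehat{\mathfrak Q})$. More precisely, if in the situation of (2) one considers the enlargement $(\mathcal G(\widehat{\mathfrak Q}),\widehat{\mathfrak Q}^\sharp)$ of $(\mathcal G,\widehat{\mathfrak P})$, then the map $J_{\mathcal G(\widehat{\mathfrak Q})}$ from $L^\infty_{\widehat{\mathbf c}}$ to the $L^\infty$-space of $(\mathcal G(\widehat{\mathfrak Q}),\widehat{\mathfrak Q}^\sharp)$ is a lattice isomorphism.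
   Context: For a measurable space $(\Omega,\mathcal F)$, $\Delta(\mathcal F)$ is the set of probability measures and $ca$ the space of finite countably additive signed measures, with total variation $|\mu|$. For nonempty $\mathfrak P\subset\Delta(\mathcal F)$ the associated upper probability is $\mathbf c(A)=\sup_{\mathbb P\in\mathfrak P}\mathbb P(A)$. A property holds $\mathfrak P$-quasi surely (q.s.) if it holds outside an event $A\in\mathcal F$ with $\mathbf c(A)=0$. $L^0_{\mathbf c}$ is the vector lattice of classes, up to $\mathfrak P$-q.s. equality, of real-valued $\mathcal F$-measurable functions, with order $X\preceq Y$ iff $f\le g$ $\mathfrak P$-q.s. for representatives; $L^\infty_{\mathbf c}=\{X\in L^0_{\mathbf c}\mid\exists m>0:\ |X|\preceq m\mathbf 1_\Omega\}$. For sets of (signed) measures, $\mathfrak S\ll\mathfrak T$ means that $\sup_{\nu\in\mathfrak T}|\nu|(N)=0$ implies $\sup_{\mu\in\mathfrak S}|\mu|(N)=0$ for all events $N$; $\mathfrak S\approx\mathfrak T$ means both $\ll$ relations. $ca_{\mathbf c}=\{\mu\in ca\mid\{\mu\}\ll\mathfrak P\}$. A measure $\mu$ is supported (w.r.t. $\mathfrak P$) if there is $S(\mu)\in\mathcal F$ with $\mu(S(\mu)^c)=0$ such that every $N\in\mathcal F$ with $\mu(N\cap S(\mu))=0$ satisfies $\mathbf c(N\cap S(\mu))=0$; a signed $\mu\in ca_{\mathbf c}$ is supported if $|\mu|$ is; $sca_{\mathbf c}$ is the set of supported $\mu\in ca_{\mathbf c}$. $\mathfrak P$ is of class (S) if there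 is a supported alternative to $\mathfrak P$, i.e. a set $\mathfrak Q\subset\Delta(\mathcal F)$ with $\mathfrak Q\approx\mathfrak P$ and $\mathfrak Q\subset sca_{\mathbf c}$. The same notions are used for $(\Omega,\mathcal G,\widehat{\mathfrak P})$ with $\widehat{\mathbf c}$ in place of $\mathbf c$. An enlargement of $(\mathcal F,\mathfrak P)$ is a tuple $(\mathcal G,\widehat{\mathfrak P})$ where $\mathcal G\supset\mathcal F$ is a $\sigma$-algebra on $\Omega$ and $\widehat{\mathfrak P}\subset\Delta(\mathcal G)$ satisfies $\{\widehat{\mathbb P}|_{\mathcal F}\mid\widehat{\mathbb P}\in\widehat{\mathfrak P}\}\approx\mathfrak P$. It induces the injective lattice homomorphism $J_{\mathcal G}:L^\infty_{\mathbf c}\to L^\infty_{\widehat{\mathbf c}}$ sending the class of an $\mathcal F$-measurable $f$ in $L^\infty_{\mathbf c}$ to its class in $L^\infty_{\widehat{\mathbf c}}$. The enlargement completes $L^\infty_{\mathbf c}$ if $L^\infty_{\widehat{\mathbf c}}$ is the Dedekind completion of $L^\infty_{\mathbf c}$ and $J_{\mathcal G}(L^\infty_{\mathbf c})$ is order dense and majorising in $L^\infty_{\widehat{\mathbf c}}$ (in particular $L^\infty_{\widehat{\mathbf c}}$ is Dedekind complete: every nonempty subset bounded above has a supremum). A sublattice $\mathcal Y$ of $\mathcal X$ is order dense if for each $0\prec x\in\mathcal X$ there is $y\in\mathcal Y$ with $0\prec y\preceq x$, and majorising if for each $x\in\mathcal X$ there is $y\in\mathcal Y$ with $x\preceq y$.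 A lattice isomorphism is a bijective lattice homomorphism. For a set $\mathfrak S$ of measures on $(\Omega,\mathcal G)$, $\mathcal G(\mathfrak S)=\bigcap_{\mu\in\mathfrak S}\sigma(\mathcal G\cup\mathfrak n(\mu))$ with $\mathfrak n(\mu)=\{A\subset\Omega\mid\exists N\in\mathcal G:\ \mu(N)=0,\ A\subset N\}$. In (2), $\widehat{\mathbb Q}$ is the extension from (1). In (3), $\widehat{\mathfrak Q}^\sharp$ is the set of unique extensions of the members of $\widehat{\mathfrak Q}$ to $\mathcal G(\widehat{\mathfrak Q})$, and $J_{\mathcal G(\widehat{\mathfrak Q})}$ is the map above for the enlargement $(\mathcal G(\widehat{\mathfrak Q}),\widehat{\mathfrak Q}^\sharp)$ of $(\mathcal G,\widehat{\mathfrak P})$. *)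

theory Defs
  imports "HOL-Probability.Probability"
begin

(* A measurable space (Omega, F) is given by M :: 'a measure, of which only space M = Omega and
   sets M = F matter.  Probability measures are elements of type 'a measure; finite signed measures
   are set functions 'a set => real.  The coercion "measure" embeds the former into the latter. *)

section \<open>Probability measures and signed measures\<close>

definition prob_measures :: "'a measure \<Rightarrow> 'a measure set" where
  "prob_measures M = {P. prob_space P \<and> sets P = sets M}"

(* Signed measures are 0 off sets M, as "measure P" is.  Hence they are determined by their values
   on events, and equality of signed measures is equality of functions. *)
definition ca :: "'a measure \<Rightarrow> ('a set \<Rightarrow> real) set" where
  "ca M = {\<mu>. (\<forall>A. A \<notin> sets M \<longrightarrow> \<mu> A = 0) \<and>
      (\<forall>A :: nat \<Rightarrow> 'a set. range A \<subseteq> sets M \<longrightarrow> disjoint_family A \<longrightarrow>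
          (\<lambda>n. \<mu> (A n)) sums \<mu> (\<Union>n. A n))}"

definition total_variation :: "'a measure \<Rightarrow> ('a set \<Rightarrow> real) \<Rightarrow> 'a set \<Rightarrow> ennreal" where
  "total_variation M \<mu> A =
     (SUP D\<in>{D. finite D \<and> D \<subseteq> sets M \<and> disjoint D \<and> \<Union>D = A}. \<Sum>B\<in>D. ennreal \<bar>\<mu> B\<bar>)"

definition upper_prob :: "'a measure set \<Rightarrow> 'a set \<Rightarrow> ennreal" where
  "upper_prob \<PP> A = (SUP P\<in>\<PP>. emeasure P A)"

definition dominated_by ::
    "'a measure \<Rightarrow> ('a set \<Rightarrow> real) set \<Rightarrow> ('a set \<Rightarrow> real) set \<Rightarrow> bool" where
  "dominated_by M S T \<longleftrightarrow>
     (\<forall>N\<in>sets M. (SUP \<nu>\<in>T. total_variation M \<nu> N) = 0 \<longrightarrow> (SUP \<mu>\<in>S. total_variation M \<mu> N) = 0)"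

definition equiv_sets ::
    "'a measure \<Rightarrow> ('a set \<Rightarrow> real) set \<Rightarrow> ('a set \<Rightarrow> real) set \<Rightarrow> bool" where
  "equiv_sets M S T \<longleftrightarrow> dominated_by M S T \<and> dominated_by M T S"

definition ca_c :: "'a measure \<Rightarrow> 'a measure set \<Rightarrow> ('a set \<Rightarrow> real) set" where
  "ca_c M \<PP> = {\<mu> \<in> ca M. dominated_by M {\<mu>} (measure ` \<PP>)}"

definition supported :: "'a measure \<Rightarrow> 'a measure set \<Rightarrow> ('a set \<Rightarrow> ennreal) \<Rightarrow> bool" where
  "supported M \<PP> \<nu> \<longleftrightarrow>
     (\<exists>S\<in>sets M. \<nu> (space M - S) = 0 \<and>
        (\<forall>N\<in>sets M. \<nu> (N \<inter> S) = 0 \<longrightarrow> upper_prob \<PP> (N \<inter> S) = 0))"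

definition sca_c :: "'a measure \<Rightarrow> 'a measure set \<Rightarrow> ('a set \<Rightarrow> real) set" where
  "sca_c M \<PP> = {\<mu> \<in> ca_c M \<PP>. supported M \<PP> (total_variation M \<mu>)}"

definition supported_alternative ::
    "'a measure \<Rightarrow> 'a measure set \<Rightarrow> 'a measure set \<Rightarrow> bool" where
  "supported_alternative M \<PP> \<QQ> \<longleftrightarrow>
     \<QQ> \<subseteq> prob_measures M \<and> equiv_sets M (measure ` \<QQ>) (measure ` \<PP>) \<and> measure ` \<QQ> \<subseteq> sca_c M \<PP>"

definition class_S :: "'a measure \<Rightarrow> 'a measure set \<Rightarrow> bool" where
  "class_S M \<PP> \<longleftrightarrow> (\<exists>\<QQ>. supported_alternative M \<PP> \<QQ>)"

lemma total_variation_measure: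
  assumes P: "P \<in> prob_measures M" and A: "A \<in> sets M"
  shows "total_variation M (measure P) A = emeasure P A"
proof -
  interpret prob_space P using P by (simp add: prob_measures_def)
  have sP: "sets P = sets M" using P by (simp add: prob_measures_def)
  have eq: "(\<Sum>B\<in>D. ennreal \<bar>measure P B\<bar>) = emeasure P A"
    if "finite D" "D \<subseteq> sets M" "disjoint D" "\<Union>D = A" for D
  proof -
    have "(\<Sum>B\<in>D. ennreal \<bar>measure P B\<bar>) = (\<Sum>B\<in>D. emeasure P B)"
      by (simp add: emeasure_eq_measure)
    also have "\<dots> = emeasure P (\<Union>B\<in>D. B)"
      using that sP by (intro sum_emeasure) (auto simp: disjoint_family_on_def disjoint_def)
    finally show ?thesis using that by simp
  qed
  have "{A} \<in> {D. finite D \<and> D \<subseteq> sets M \<and> disjoint D \<and> \<Union>D = A}"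
    using A by (auto simp: disjoint_def)
  then have "total_variation M (measure P) A =
      (SUP D\<in>{D. finite D \<and> D \<subseteq> sets M \<and> disjoint D \<and> \<Union>D = A}. emeasure P A)"
    unfolding total_variation_def by (intro SUP_cong refl) (use eq in blast)
  also have "\<dots> = emeasure P A"
    using \<open>{A} \<in> _\<close> by (intro cSUP_const) blast
  finally show ?thesis .
qed

section \<open>Vector lattices\<close>

record 'e vlattice =
  elems :: "'e set"
  vzero :: 'e
  vadd :: "'e \<Rightarrow> 'e \<Rightarrow> 'e"
  vscale :: "real \<Rightarrow> 'e \<Rightarrow> 'e"
  vle :: "'e \<Rightarrow> 'e \<Rightarrow> bool"

definition is_supremum :: "('e, 'm) vlattice_scheme \<Rightarrow> 'e set \<Rightarrow> 'e \<Rightarrow> bool" where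
  "is_supremum V A s \<longleftrightarrow> s \<in> elems V \<and> (\<forall>a\<in>A. vle V a s) \<and>
     (\<forall>u\<in>elems V. (\<forall>a\<in>A. vle V a u) \<longrightarrow> vle V s u)"

definition is_infimum :: "('e, 'm) vlattice_scheme \<Rightarrow> 'e set \<Rightarrow> 'e \<Rightarrow> bool" where
  "is_infimum V A s \<longleftrightarrow> s \<in> elems V \<and> (\<forall>a\<in>A. vle V s a) \<and>
     (\<forall>l\<in>elems V. (\<forall>a\<in>A. vle V l a) \<longrightarrow> vle V l s)"

definition lattice_hom ::
    "('e, 'm) vlattice_scheme \<Rightarrow> ('f, 'n) vlattice_scheme \<Rightarrow> ('e \<Rightarrow> 'f) \<Rightarrow> bool" where
  "lattice_hom V W T \<longleftrightarrow>
     T ` elems V \<subseteq> elems W \<and>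
     (\<forall>x\<in>elems V. \<forall>y\<in>elems V. T (vadd V x y) = vadd W (T x) (T y)) \<and>
     (\<forall>a. \<forall>x\<in>elems V. T (vscale V a x) = vscale W a (T x)) \<and>
     (\<forall>x\<in>elems V. \<forall>y\<in>elems V. \<forall>s. is_supremum V {x, y} s \<longrightarrow> is_supremum W {T x, T y} (T s)) \<and>
     (\<forall>x\<in>elems V. \<forall>y\<in>elems V. \<forall>s. is_infimum V {x, y} s \<longrightarrow> is_infimum W {T x, T y} (T s))"

definition lattice_isomorphism ::
    "('e, 'm) vlattice_scheme \<Rightarrow> ('f, 'n) vlattice_scheme \<Rightarrow> ('e \<Rightarrow> 'f) \<Rightarrow> bool" where
  "lattice_isomorphism V W T \<longleftrightarrow> lattice_hom V W T \<and> bij_betw T (elems V) (elems W)"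

definition vless :: "('e, 'm) vlattice_scheme \<Rightarrow> 'e \<Rightarrow> 'e \<Rightarrow> bool" where
  "vless V x y \<longleftrightarrow> vle V x y \<and> x \<noteq> y"

definition order_dense :: "('e, 'm) vlattice_scheme \<Rightarrow> 'e set \<Rightarrow> bool" where
  "order_dense V Y \<longleftrightarrow>
     (\<forall>x\<in>elems V. vless V (vzero V) x \<longrightarrow> (\<exists>y\<in>Y. vless V (vzero V) y \<and> vle V y x))"

definition majorising :: "('e, 'm) vlattice_scheme \<Rightarrow> 'e set \<Rightarrow> bool" where
  "majorising V Y \<longleftrightarrow> (\<forall>x\<in>elems V. \<exists>y\<in>Y. vle V x y)"

definition dedekind_complete :: "('e, 'm) vlattice_scheme \<Rightarrow> bool" where
  "dedekind_complete V \<longleftrightarrow>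
     (\<forall>A. A \<subseteq> elems V \<longrightarrow> A \<noteq> {} \<longrightarrow> (\<exists>u\<in>elems V. \<forall>a\<in>A. vle V a u) \<longrightarrow> (\<exists>s. is_supremum V A s))"

definition dedekind_completion ::
    "('e, 'm) vlattice_scheme \<Rightarrow> ('f, 'n) vlattice_scheme \<Rightarrow> ('e \<Rightarrow> 'f) \<Rightarrow> bool" where
  "dedekind_completion V W T \<longleftrightarrow>
     dedekind_complete W \<and> lattice_hom V W T \<and> inj_on T (elems V) \<and>
     order_dense W (T ` elems V) \<and> majorising W (T ` elems V)"

section \<open>The spaces of quasi-sure equivalence classes\<close>

definition qs :: "'a measure \<Rightarrow> 'a measure set \<Rightarrow> ('a \<Rightarrow> bool) \<Rightarrow> bool" where
  "qs M \<PP> \<phi> \<longleftrightarrow> (\<exists>N\<in>sets M. upper_prob \<PP> N = 0 \<and> (\<forall>\<omega>\<in>space M - N. \<phi> \<omega>))"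

definition qs_eq_rel :: "'a measure \<Rightarrow> 'a measure set \<Rightarrow> (('a \<Rightarrow> real) \<times> ('a \<Rightarrow> real)) set" where
  "qs_eq_rel M \<PP> = {(f, g). f \<in> borel_measurable M \<and> g \<in> borel_measurable M \<and>
     qs M \<PP> (\<lambda>\<omega>. f \<omega> = g \<omega>)}"

definition qs_class :: "'a measure \<Rightarrow> 'a measure set \<Rightarrow> ('a \<Rightarrow> real) \<Rightarrow> ('a \<Rightarrow> real) set" where
  "qs_class M \<PP> f = qs_eq_rel M \<PP> `` {f}"

(* On classes, the operations are defined by taking the union over all representatives; each
   such union is a single class because the operations respect q.s. equality. *)
definition L0 :: "'a measure \<Rightarrow> 'a measure set \<Rightarrow> ('a \<Rightarrow> real) set vlattice" where
  "L0 M \<PP> = \<lparr>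
     elems = borel_measurable M // qs_eq_rel M \<PP>,
     vzero = qs_class M \<PP> (\<lambda>_. 0),
     vadd = (\<lambda>X Y. \<Union>f\<in>X. \<Union>g\<in>Y. qs_class M \<PP> (\<lambda>\<omega>. f \<omega> + g \<omega>)),
     vscale = (\<lambda>a X. \<Union>f\<in>X. qs_class M \<PP> (\<lambda>\<omega>. a * f \<omega>)),
     vle = (\<lambda>X Y. \<exists>f\<in>X. \<exists>g\<in>Y. qs M \<PP> (\<lambda>\<omega>. f \<omega> \<le> g \<omega>)) \<rparr>"

definition L0_abs ::
    "'a measure \<Rightarrow> 'a measure set \<Rightarrow> ('a \<Rightarrow> real) set \<Rightarrow> ('a \<Rightarrow> real) set" where
  "L0_abs M \<PP> X = (\<Union>f\<in>X. qs_class M \<PP> (\<lambda>\<omega>. \<bar>f \<omega>\<bar>))"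

definition Linf :: "'a measure \<Rightarrow> 'a measure set \<Rightarrow> ('a \<Rightarrow> real) set vlattice" where
  "Linf M \<PP> = (L0 M \<PP>)\<lparr>elems :=
     {X \<in> elems (L0 M \<PP>). \<exists>m>0. vle (L0 M \<PP>) (L0_abs M \<PP> X) (qs_class M \<PP> (\<lambda>_. m))}\<rparr>"

lemma qs_conj:
  assumes "\<PP> \<subseteq> prob_measures M" "qs M \<PP> \<phi>" "qs M \<PP> \<psi>"
  shows "qs M \<PP> (\<lambda>\<omega>. \<phi> \<omega> \<and> \<psi> \<omega>)"
proof -
  obtain N N' where N: "N \<in> sets M" "upper_prob \<PP> N = 0" "\<forall>\<omega>\<in>space M - N. \<phi> \<omega>"
    and N': "N' \<in> sets M" "upper_prob \<PP> N' = 0" "\<forall>\<omega>\<in>space M - N'. \<psi> \<omega>"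
    using assms(2,3) unfolding qs_def by blast
  have "emeasure P (N \<union> N') = 0" if P: "P \<in> \<PP>" for P
  proof -
    have le: "emeasure P A \<le> upper_prob \<PP> A" for A
      unfolding upper_prob_def by (intro SUP_upper P)
    have "sets P = sets M" using P assms(1) by (auto simp: prob_measures_def)
    then have "N \<in> null_sets P" "N' \<in> null_sets P"
      using le[of N] le[of N'] N N' by auto
    then have "N \<union> N' \<in> null_sets P" by (rule null_sets.Un)
    then show ?thesis by auto
  qed
  then have "upper_prob \<PP> (N \<union> N') \<le> 0"
    unfolding upper_prob_def by (intro SUP_least) auto
  then have "upper_prob \<PP> (N \<union> N') = 0" by simp
  with N N' show ?thesis
    unfolding qs_def by (intro bexI[of _ "N \<union> N'"]) auto
qed

lemma qs_mono: "qs M \<PP> \<phi> \<Longrightarrow> (\<And>\<omega>. \<omega> \<in> space M \<Longrightarrow> \<phi> \<omega> \<Longrightarrow> \<psi> \<omega>) \<Longrightarrow> qs M \<PP> \<psi>"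
  unfolding qs_def by blast

lemma equiv_qs_eq_rel:
  assumes "\<PP> \<subseteq> prob_measures M"
  shows "equiv (borel_measurable M) (qs_eq_rel M \<PP>)"
proof (rule equivI)
  show "qs_eq_rel M \<PP> \<subseteq> borel_measurable M \<times> borel_measurable M"
    by (auto simp: qs_eq_rel_def)
  have "upper_prob \<PP> {} = 0"
    by (cases "\<PP> = {}") (auto simp: upper_prob_def bot_ennreal)
  then show "refl_on (borel_measurable M) (qs_eq_rel M \<PP>)"
    by (auto simp: refl_on_def qs_eq_rel_def qs_def intro!: bexI[of _ "{}"])
  show "sym (qs_eq_rel M \<PP>)"
    by (auto simp: sym_def qs_eq_rel_def eq_commute)
  show "trans (qs_eq_rel M \<PP>)"
  proof (rule transI)
    fix f g h assume *: "(f, g) \<in> qs_eq_rel M \<PP>" "(g, h) \<in> qs_eq_rel M \<PP>"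
    then have "qs M \<PP> (\<lambda>\<omega>. f \<omega> = g \<omega> \<and> g \<omega> = h \<omega>)"
      by (intro qs_conj assms) (auto simp: qs_eq_rel_def)
    then have "qs M \<PP> (\<lambda>\<omega>. f \<omega> = h \<omega>)"
      by (rule qs_mono) simp
    with * show "(f, h) \<in> qs_eq_rel M \<PP>"
      by (auto simp: qs_eq_rel_def)
  qed
qed

lemma L0_vadd_class:
  assumes "\<PP> \<subseteq> prob_measures M" "f \<in> borel_measurable M" "g \<in> borel_measurable M"
  shows "vadd (L0 M \<PP>) (qs_class M \<PP> f) (qs_class M \<PP> g) = qs_class M \<PP> (\<lambda>\<omega>. f \<omega> + g \<omega>)"
proof -
  note E = equiv_qs_eq_rel[OF assms(1)]
  have "qs_class M \<PP> (\<lambda>\<omega>. f' \<omega> + g' \<omega>) = qs_class M \<PP> (\<lambda>\<omega>. f \<omega> + g \<omega>)"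
    if "f' \<in> qs_class M \<PP> f" "g' \<in> qs_class M \<PP> g" for f' g'
  proof -
    have *: "(f, f') \<in> qs_eq_rel M \<PP>" "(g, g') \<in> qs_eq_rel M \<PP>"
      using that by (auto simp: qs_class_def)
    then have "qs M \<PP> (\<lambda>\<omega>. f \<omega> = f' \<omega> \<and> g \<omega> = g' \<omega>)"
      by (intro qs_conj assms) (auto simp: qs_eq_rel_def)
    then have "qs M \<PP> (\<lambda>\<omega>. f \<omega> + g \<omega> = f' \<omega> + g' \<omega>)"
      by (rule qs_mono) simp
    then have "((\<lambda>\<omega>. f \<omega> + g \<omega>), (\<lambda>\<omega>. f' \<omega> + g' \<omega>)) \<in> qs_eq_rel M \<PP>"
      using * by (auto simp: qs_eq_rel_def)
    then show ?thesis
      unfolding qs_class_def using equiv_class_eq[OF E] by metis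
  qed
  moreover have "f \<in> qs_class M \<PP> f" "g \<in> qs_class M \<PP> g"
    using equiv_class_self[OF E] assms by (auto simp: qs_class_def)
  ultimately have "(\<Union>f'\<in>qs_class M \<PP> f. \<Union>g'\<in>qs_class M \<PP> g. qs_class M \<PP> (\<lambda>\<omega>. f' \<omega> + g' \<omega>)) =
      qs_class M \<PP> (\<lambda>\<omega>. f \<omega> + g \<omega>)"
    by blast
  then show ?thesis
    by (simp add: L0_def)
qed

section \<open>Enlargements\<close>

definition enlargement ::
    "'a measure \<Rightarrow> 'a measure set \<Rightarrow> 'a measure \<Rightarrow> 'a measure set \<Rightarrow> bool" where
  "enlargement M \<PP> G \<PP>' \<longleftrightarrow>
     subalgebra G M \<and> \<PP>' \<subseteq> prob_measures G \<and>
     equiv_sets M (measure ` (\<lambda>P. restr_to_subalg P M) ` \<PP>') (measure ` \<PP>)"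

(* The class of f is sent to the class of f: all f in X have the same class for \<PP>' as soon as
   (G, \<PP>') is an enlargement. *)
definition J_map ::
    "'a measure \<Rightarrow> 'a measure set \<Rightarrow> ('a \<Rightarrow> real) set \<Rightarrow> ('a \<Rightarrow> real) set" where
  "J_map G \<PP>' X = (\<Union>f\<in>X. qs_class G \<PP>' f)"

lemma J_map_qs_class:
  assumes E: "enlargement M \<PP> G \<PP>'" and P: "\<PP> \<subseteq> prob_measures M" and f: "f \<in> borel_measurable M"
  shows "J_map G \<PP>' (qs_class M \<PP> f) = qs_class G \<PP>' f"
proof -
  have sub: "subalgebra G M" and P': "\<PP>' \<subseteq> prob_measures G"
    using E by (auto simp: enlargement_def)
  have null: "upper_prob \<PP>' N = 0" if N: "N \<in> sets M" "upper_prob \<PP> N = 0" for N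
  proof -
    have tv: "total_variation M (measure P) N \<le> 0" if "P \<in> \<PP>" for P
    proof -
      have "total_variation M (measure P) N = emeasure P N"
        using that P N by (intro total_variation_measure) auto
      also have "\<dots> \<le> upper_prob \<PP> N"
        unfolding upper_prob_def by (intro SUP_upper that)
      finally show ?thesis using N by simp
    qed
    have "(SUP \<nu>\<in>measure ` \<PP>. total_variation M \<nu> N) \<le> 0"
      by (rule SUP_least) (use tv in blast)
    then have "(SUP \<nu>\<in>measure ` (\<lambda>P. restr_to_subalg P M) ` \<PP>'. total_variation M \<nu> N) = 0"
      using E N by (auto simp: enlargement_def equiv_sets_def dominated_by_def)
    then have tv': "total_variation M (measure (restr_to_subalg P M)) N \<le> 0" if "P \<in> \<PP>'" for P
      using that by (metis SUP_upper imageI)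
    have "emeasure P N \<le> 0" if "P \<in> \<PP>'" for P
    proof -
      have sG: "sets P = sets G" "prob_space P" using that P' by (auto simp: prob_measures_def)
      then have sP: "subalgebra P M"
        using sub sets_eq_imp_space_eq[of P G] by (simp add: subalgebra_def)
      have "restr_to_subalg P M \<in> prob_measures M"
        using prob_space_restr_to_subalg[OF sP sG(2)] sets_restr_to_subalg[OF sP]
        by (simp add: prob_measures_def)
      then have "total_variation M (measure (restr_to_subalg P M)) N = emeasure P N"
        using N sP by (simp add: total_variation_measure emeasure_restr_to_subalg)
      then show ?thesis using tv'[OF that] by simp
    qed
    then have "upper_prob \<PP>' N \<le> 0"
      unfolding upper_prob_def by (intro SUP_least)
    then show ?thesis by simp
  qed
  have qs: "qs G \<PP>' \<phi>" if "qs M \<PP> \<phi>" for \<phi>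
    using that null sub unfolding qs_def subalgebra_def by blast
  have "qs_class G \<PP>' g = qs_class G \<PP>' f" if "g \<in> qs_class M \<PP> f" for g
  proof -
    have "(f, g) \<in> qs_eq_rel G \<PP>'"
      using that sub qs
      by (auto simp: qs_class_def qs_eq_rel_def intro: measurable_from_subalg)
    then show ?thesis
      unfolding qs_class_def using equiv_class_eq[OF equiv_qs_eq_rel[OF P']] by metis
  qed
  moreover have "f \<in> qs_class M \<PP> f"
    using equiv_class_self[OF equiv_qs_eq_rel[OF P]] f by (auto simp: qs_class_def)
  ultimately show ?thesis
    unfolding J_map_def by blast
qed

definition completes_Linf ::
    "'a measure \<Rightarrow> 'a measure set \<Rightarrow> 'a measure \<Rightarrow> 'a measure set \<Rightarrow> bool" where
  "completes_Linf M \<PP> G \<PP>' \<longleftrightarrow>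
     enlargement M \<PP> G \<PP>' \<and> dedekind_completion (Linf M \<PP>) (Linf G \<PP>') (J_map G \<PP>')"

definition sca_extension ::
    "'a measure \<Rightarrow> 'a measure \<Rightarrow> 'a measure set \<Rightarrow> ('a set \<Rightarrow> real) \<Rightarrow> ('a set \<Rightarrow> real) \<Rightarrow> bool" where
  "sca_extension M G \<PP>' \<mu> \<nu> \<longleftrightarrow> \<nu> \<in> sca_c G \<PP>' \<and> (\<forall>A\<in>sets M. \<nu> A = \<mu> A)"

definition sca_ext ::
    "'a measure \<Rightarrow> 'a measure \<Rightarrow> 'a measure set \<Rightarrow> ('a set \<Rightarrow> real) \<Rightarrow> ('a set \<Rightarrow> real)" where
  "sca_ext M G \<PP>' \<mu> = (THE \<nu>. sca_extension M G \<PP>' \<mu> \<nu>)"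

(* The signed measure sca_ext M G \<PP>' (measure Q), turned back into an 'a measure. *)
definition prob_ext :: "'a measure \<Rightarrow> 'a measure \<Rightarrow> 'a measure set \<Rightarrow> 'a measure \<Rightarrow> 'a measure" where
  "prob_ext M G \<PP>' Q =
     measure_of (space G) (sets G) (\<lambda>A. ennreal (sca_ext M G \<PP>' (measure Q) A))"

definition null_subsets :: "'a measure \<Rightarrow> 'a measure \<Rightarrow> 'a set set" where
  "null_subsets G \<mu> = {A. A \<subseteq> space G \<and> (\<exists>N\<in>sets G. emeasure \<mu> N = 0 \<and> A \<subseteq> N)}"

(* The set generating the sigma-algebra below is itself a sigma-algebra; "sigma" only packages it
   as a measurable space. *)
definition joint_completion :: "'a measure \<Rightarrow> 'a measure set \<Rightarrow> 'a measure" where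
  "joint_completion G S =
     sigma (space G) (Pow (space G) \<inter>
       (\<Inter>\<mu>\<in>S. sigma_sets (space G) (sets G \<union> null_subsets G \<mu>)))"

definition joint_completion_probs :: "'a measure \<Rightarrow> 'a measure set \<Rightarrow> 'a measure set" where
  "joint_completion_probs G S =
     {R \<in> prob_measures (joint_completion G S). restr_to_subalg R G \<in> S}"

end

(* Order density alone gives (1) and (2): if mu is supported by S, then every A in G with A a subset
   of S is quasi-surely equal to an event B of F, namely one that maximises |mu| among the
   F-measurable quasi-sure subsets of A; order density would allow a larger one if A - B were not
   negligible.  Hence the extension has to be, and can be, defined by A |-> mu(B) on S, and it
   vanishes off S.  Uniqueness follows by applying the same argument to |nu1| + |nu2| for two supported
   extensions nu1, nu2.

   Dedekind completeness is needed only for surjectivity in (3).  Given a bounded function f that is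
   measurable for the joint completion, let N_Q be a G-measurable Q-null set off which f is
   G-measurable.  The supremum over Q of the functions that equal f off N_Q and a lower bound
   of f on N_Q is quasi-surely equal to f, because redefining it as f off a single N_Q gives another
   upper bound. *)
theory Submission
  imports Defs
begin

section \<open>Signed measures\<close>

text \<open>Maximising needs a finite, monotone set function, while \<open>total_variation\<close>
  is a supremum in \<open>ennreal\<close> whose finiteness is not built into its definition. A Hahn
  set \<open>H\<close> provides a real-valued substitute,
  \<open>v A = \<mu> (A \<inter> H) - \<mu> (A - H)\<close>: it is nonnegative and additive, and its
  null events are null for the total variation. Supportedness then turns a leftover piece with
  \<open>v = 0\<close> into a quasi-surely null one. Off the support every event has
  \<open>v = 0\<close>, so a maximiser would say nothing there; hence the cut by the support. In (3)
  the obstacle is that the exceptional sets depend on Q: a set null for one Q may be charged by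
  another, and uncountably many of them cannot be collected into a single null set. The supremum in
  the Dedekind complete lattice replaces this gluing. A lower bound is the right filling on an
  exceptional set because it never interferes with what the other measures prescribe there.\<close>

lemma ca_sums:
  "\<mu> \<in> ca M \<Longrightarrow> range A \<subseteq> sets M \<Longrightarrow> disjoint_family A \<Longrightarrow> (\<lambda>n. \<mu> (A n)) sums \<mu> (\<Union>n. A n)"
  by (auto simp: ca_def)

text \<open>A constant series converges only if its terms are 0, and the empty set is the disjoint
  union of copies of itself.\<close>

lemma ca_empty: assumes "\<mu> \<in> ca M" shows "\<mu> {} = 0"
proof -
  have "(\<lambda>n::nat. \<mu> {}) sums \<mu> (\<Union>n::nat. {})"
    using assms by (intro ca_sums) (auto simp: disjoint_family_on_def)
  then have "(\<lambda>n::nat. \<mu> {}) \<longlonglongrightarrow> 0"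
    by (intro summable_LIMSEQ_zero) (rule sums_summable)
  then show ?thesis by (simp add: LIMSEQ_const_iff)
qed

lemma ca_Un:
  assumes \<mu>: "\<mu> \<in> ca M" and "A \<in> sets M" "B \<in> sets M" "A \<inter> B = {}"
  shows "\<mu> (A \<union> B) = \<mu> A + \<mu> B"
proof -
  have "(\<lambda>n. \<mu> (binaryset A B n)) sums \<mu> (\<Union>n. binaryset A B n)"
    using assms by (intro ca_sums) (auto simp: range_binaryset_eq disjoint_family_on_def binaryset_def)
  moreover have "(\<lambda>n. \<mu> (binaryset A B n)) sums (\<mu> A + \<mu> B)"
    using ca_empty[OF \<mu>] by (intro binaryset_sums)
  ultimately show ?thesis
    using sums_unique2 by (fastforce simp: UN_binaryset_eq)
qed

lemma ca_split:
  assumes "\<mu> \<in> ca M" "A \<in> sets M" "B \<in> sets M"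
  shows "\<mu> A = \<mu> (A \<inter> B) + \<mu> (A - B)"
proof -
  have "\<mu> ((A \<inter> B) \<union> (A - B)) = \<mu> (A \<inter> B) + \<mu> (A - B)"
    using assms by (intro ca_Un) auto
  then show ?thesis by (simp add: Int_Diff_Un)
qed

lemma ca_Diff:
  assumes "\<mu> \<in> ca M" "A \<in> sets M" "B \<in> sets M" "B \<subseteq> A"
  shows "\<mu> (A - B) = \<mu> A - \<mu> B"
  using ca_split[OF assms(1-3)] assms(4) by (simp add: Int_absorb1)

text \<open>Domination and supportedness see the total variation only through its null events; this
  describes them by values of \<open>\<mu>\<close> alone.\<close>

lemma total_variation_eq_0_iff:
  assumes \<mu>: "\<mu> \<in> ca M" and A: "A \<in> sets M"
  shows "total_variation M \<mu> A = 0 \<longleftrightarrow> (\<forall>B\<in>sets M. B \<subseteq> A \<longrightarrow> \<mu> B = 0)"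
proof
  assume 0: "total_variation M \<mu> A = 0"
  show "\<forall>B\<in>sets M. B \<subseteq> A \<longrightarrow> \<mu> B = 0"
  proof (intro ballI impI)
    fix B assume B: "B \<in> sets M" "B \<subseteq> A"
    have "ennreal \<bar>\<mu> B\<bar> \<le> (\<Sum>C\<in>{B, A - B}. ennreal \<bar>\<mu> C\<bar>)"
      by (rule member_le_sum) auto
    also have "\<dots> \<le> total_variation M \<mu> A"
      unfolding total_variation_def using A B by (intro SUP_upper) (auto simp: disjoint_def)
    finally show "\<mu> B = 0" using 0 by simp
  qed
next
  assume *: "\<forall>B\<in>sets M. B \<subseteq> A \<longrightarrow> \<mu> B = 0"
  have "total_variation M \<mu> A \<le> 0"
    unfolding total_variation_def
  proof (rule SUP_least)
    fix D assume "D \<in> {D. finite D \<and> D \<subseteq> sets M \<and> disjoint D \<and> \<Union> D = A}"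
    then have "\<mu> B = 0" if "B \<in> D" for B using * that by auto
    then show "(\<Sum>B\<in>D. ennreal \<bar>\<mu> B\<bar>) \<le> 0" by simp
  qed
  then show "total_variation M \<mu> A = 0" by simp
qed

text \<open>The union of a maximising sequence stays in \<open>\<D>\<close> and, by monotonicity,
  reaches the supremum. Boundedness comes from the same argument: the union of sets with
  \<open>v (B n) > n\<close> would have a value above every \<open>n\<close>.\<close>

lemma exhaustion:
  fixes v :: "'a set \<Rightarrow> real"
  assumes ne: "\<D> \<noteq> {}"
    and Un: "\<And>B :: nat \<Rightarrow> 'a set. range B \<subseteq> \<D> \<Longrightarrow> (\<Union>n. B n) \<in> \<D>"
    and mono: "\<And>B C. B \<in> \<D> \<Longrightarrow> C \<in> \<D> \<Longrightarrow> B \<subseteq> C \<Longrightarrow> v B \<le> v C"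
  shows "\<exists>B\<in>\<D>. \<forall>C\<in>\<D>. v C \<le> v B"
proof -
  have le: "v (B n) \<le> v (\<Union>n. B n)" if "range B \<subseteq> \<D>" for B :: "nat \<Rightarrow> 'a set" and n
    using Un[OF that] that by (intro mono) auto
  have bdd: "bdd_above (v ` \<D>)"
  proof (rule ccontr)
    assume "\<not> bdd_above (v ` \<D>)"
    then have "\<forall>n::nat. \<exists>B\<in>\<D>. real n < v B"
      by (force simp: bdd_above_def not_le)
    then obtain B where B: "\<And>n::nat. B n \<in> \<D>" "\<And>n. real n < v (B n)" by metis
    obtain n where "v (\<Union>n. B n) < real n" using reals_Archimedean2 by blast
    moreover have "v (B n) \<le> v (\<Union>n. B n)" using B(1) by (intro le) auto
    ultimately show False using B(2)[of n] by simp
  qed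
  have "\<forall>n::nat. \<exists>B\<in>\<D>. (SUP B\<in>\<D>. v B) - inverse (Suc n) < v B"
  proof
    fix n :: nat
    have "(SUP B\<in>\<D>. v B) - inverse (Suc n) < (SUP B\<in>\<D>. v B)" by simp
    then show "\<exists>B\<in>\<D>. (SUP B\<in>\<D>. v B) - inverse (Suc n) < v B"
      by (subst (asm) less_cSUP_iff[OF ne bdd])
  qed
  then obtain B where B: "\<And>n::nat. B n \<in> \<D>" "\<And>n. (SUP B\<in>\<D>. v B) - inverse (Suc n) < v (B n)"
    by metis
  have "(SUP B\<in>\<D>. v B) \<le> v (\<Union>n. B n)"
  proof (rule field_le_epsilon)
    fix e :: real assume "0 < e"
    then obtain n where n: "inverse (Suc n) < e" using reals_Archimedean by blast
    have "v (B n) \<le> v (\<Union>n. B n)" using B(1) by (intro le) auto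
    then show "(SUP B\<in>\<D>. v B) \<le> v (\<Union>n. B n) + e" using B(2)[of n] n by simp
  qed
  moreover have "v C \<le> (SUP B\<in>\<D>. v B)" if "C \<in> \<D>" for C
    using that bdd by (rule cSUP_upper)
  ultimately show ?thesis
    using B(1) Un[of B] by (meson image_subsetI order_trans)
qed

section \<open>Hahn decomposition of a signed measure\<close>

definition positive_on :: "'a measure \<Rightarrow> ('a set \<Rightarrow> real) \<Rightarrow> 'a set \<Rightarrow> bool" where
  "positive_on M \<mu> A \<longleftrightarrow> (\<forall>B\<in>sets M. B \<subseteq> A \<longrightarrow> 0 \<le> \<mu> B)"

lemma ca_positive_subset:
  assumes \<mu>: "\<mu> \<in> ca M" and A: "A \<in> sets M"
  obtains P where "P \<in> sets M" "P \<subseteq> A" "positive_on M \<mu> P" "\<mu> A \<le> \<mu> P"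
proof -
  \<comment> \<open>Greedily remove pieces on which the measure is, up to a factor, as negative as possible; capping
    at 1 avoids having to know beforehand that the measure is bounded.\<close>
  have ex: "\<exists>C\<in>sets M. C \<subseteq> B \<and> \<mu> C \<le> 0 \<and> (\<forall>C'\<in>sets M. C' \<subseteq> B \<longrightarrow> min 1 (- \<mu> C') / 2 \<le> - \<mu> C)" for B
  proof -
    define t where "t = (SUP C\<in>{C \<in> sets M. C \<subseteq> B}. min 1 (- \<mu> C))"
    have ne: "{C \<in> sets M. C \<subseteq> B} \<noteq> {}" by auto
    have bdd: "bdd_above ((\<lambda>C. min 1 (- \<mu> C)) ` {C \<in> sets M. C \<subseteq> B})"
      by (rule bdd_aboveI[of _ 1]) auto
    have up: "min 1 (- \<mu> C) \<le> t" if "C \<in> sets M" "C \<subseteq> B" for C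
      unfolding t_def using that by (intro cSUP_upper bdd) auto
    have "0 \<le> t" using up[of "{}"] ca_empty[OF \<mu>] by simp
    show ?thesis
    proof (cases "t = 0")
      case True
      then show ?thesis using up ca_empty[OF \<mu>] by (intro bexI[of _ "{}"]) auto
    next
      case False
      then have "t / 2 < t" using \<open>0 \<le> t\<close> by simp
      then obtain C where C: "C \<in> sets M" "C \<subseteq> B" "t / 2 < min 1 (- \<mu> C)"
        using less_cSUP_iff[OF ne bdd, of "t / 2"] unfolding t_def[symmetric] by auto
      have "min 1 (- \<mu> C') / 2 \<le> - \<mu> C" if "C' \<in> sets M" "C' \<subseteq> B" for C'
        using up[OF that] C(3) by linarith
      then show ?thesis using C \<open>0 \<le> t\<close> by (intro bexI[of _ C]) auto
    qed
  qed
  then obtain c where c: "\<And>B. c B \<in> sets M" "\<And>B. c B \<subseteq> B" "\<And>B. \<mu> (c B) \<le> 0"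
      "\<And>B C'. C' \<in> sets M \<Longrightarrow> C' \<subseteq> B \<Longrightarrow> min 1 (- \<mu> C') / 2 \<le> - \<mu> (c B)"
    by metis
  define R where "R n = ((\<lambda>B. B - c B) ^^ n) A" for n
  define C where "C n = c (R n)" for n
  have R_Suc: "R (Suc n) = R n - C n" for n by (simp add: R_def C_def)
  have R_eq: "R n = A - (\<Union>k<n. C k)" for n
    by (induction n) (auto simp: R_Suc lessThan_Suc, simp_all add: R_def)
  have C: "C n \<in> sets M" "C n \<subseteq> R n" "\<mu> (C n) \<le> 0" for n
    using c by (auto simp: C_def)
  have "disjoint_family C"
    unfolding disjoint_family_on_def
  proof (intro ballI impI)
    fix m n :: nat assume "m \<noteq> n"
    moreover have "C m \<inter> C n = {}" if "m < n" for m n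
      using C(2)[of n] that by (auto simp: R_eq)
    ultimately show "C m \<inter> C n = {}" by (metis Int_commute linorder_neqE_nat)
  qed
  then have sums: "(\<lambda>n. \<mu> (C n)) sums \<mu> (\<Union>n. C n)"
    using \<mu> C(1) by (intro ca_sums) auto
  have UC: "(\<Union>n. C n) \<in> sets M" using C(1) by auto
  have UC_sub: "(\<Union>n. C n) \<subseteq> A" using C(2) by (auto simp: R_eq)
  show ?thesis
  proof (rule that[of "A - (\<Union>n. C n)"])
    show "A - (\<Union>n. C n) \<in> sets M" using A UC by auto
    have "\<mu> (\<Union>n. C n) \<le> 0" using sums_le[OF _ sums sums_zero] C(3) by simp
    then show "\<mu> A \<le> \<mu> (A - (\<Union>n. C n))" using ca_Diff[OF \<mu> A UC UC_sub] by simp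
    show "positive_on M \<mu> (A - (\<Union>n. C n))"
      unfolding positive_on_def
    proof (intro ballI impI)
      fix B assume B: "B \<in> sets M" "B \<subseteq> A - (\<Union>n. C n)"
      \<comment> \<open>\<open>B\<close> lies in every remainder \<open>R n\<close>, so each removed
        piece was at least half as negative as \<open>B\<close>, up to the cap. The values of the
        removed pieces form a convergent series and tend to 0, so nothing negative can be
        left.\<close>
      have "min 1 (- \<mu> B) / 2 \<le> - \<mu> (C n)" for n
        unfolding C_def using B by (intro c(4)) (auto simp: R_eq)
      moreover have "(\<lambda>n. - \<mu> (C n)) \<longlonglongrightarrow> - 0"
        using sums by (intro tendsto_minus summable_LIMSEQ_zero) (rule sums_summable)
      ultimately have "min 1 (- \<mu> B) / 2 \<le> - 0" by (intro LIMSEQ_le_const) auto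
      then show "0 \<le> \<mu> B" by simp
    qed
  qed auto
qed

lemma positive_on_UN:
  assumes \<mu>: "\<mu> \<in> ca M" and P: "range P \<subseteq> sets M" "\<And>n::nat. positive_on M \<mu> (P n)"
  shows "positive_on M \<mu> (\<Union>n. P n)"
  unfolding positive_on_def
proof (intro ballI impI)
  fix B assume B: "B \<in> sets M" "B \<subseteq> (\<Union>n. P n)"
  have dP: "disjointed P n \<in> sets M" for n
    using sets.range_disjointed_sets[OF P(1)] by auto
  have "(\<lambda>n. \<mu> (B \<inter> disjointed P n)) sums \<mu> (\<Union>n. B \<inter> disjointed P n)"
  proof (rule ca_sums[OF \<mu>])
    show "disjoint_family (\<lambda>n. B \<inter> disjointed P n)"
      by (rule disjoint_family_on_bisimulation[OF disjoint_family_disjointed[of P]]) blast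
  qed (use B dP in auto)
  moreover have "(\<Union>n. B \<inter> disjointed P n) = B"
    using B(2) UN_disjointed_eq[of P] by blast
  moreover have "0 \<le> \<mu> (B \<inter> disjointed P n)" for n
    using P(2)[of n] B dP[of n] disjointed_subset[of P n] unfolding positive_on_def by blast
  ultimately show "0 \<le> \<mu> B" using sums_le[OF _ sums_zero] by metis
qed

text \<open>\<open>H\<close> maximises \<open>\<mu>\<close> among the positive sets; an event
  disjoint from \<open>H\<close> of positive measure would contain a positive set that could be
  added to \<open>H\<close>.\<close>

lemma Hahn_decomposition_ca:
  assumes \<mu>: "\<mu> \<in> ca M"
  obtains H where "H \<in> sets M" "positive_on M \<mu> H"
    "\<And>B. B \<in> sets M \<Longrightarrow> B \<inter> H = {} \<Longrightarrow> \<mu> B \<le> 0"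
proof -
  define \<D> where "\<D> = {P \<in> sets M. positive_on M \<mu> P}"
  have *: "\<mu> C = \<mu> B + \<mu> (C - B)" if "B \<in> sets M" "C \<in> sets M" "B \<subseteq> C" for B C
    using ca_Diff[OF \<mu>, of C B] that by simp
  have "\<exists>H\<in>\<D>. \<forall>C\<in>\<D>. \<mu> C \<le> \<mu> H"
  proof (rule exhaustion[of \<D> \<mu>])
    show "\<D> \<noteq> {}" using ca_empty[OF \<mu>] by (auto simp: \<D>_def positive_on_def intro!: exI[of _ "{}"])
    show "(\<Union>n. B n) \<in> \<D>" if "range B \<subseteq> \<D>" for B :: "nat \<Rightarrow> 'a set"
      using that by (auto simp: \<D>_def image_subset_iff intro!: positive_on_UN[OF \<mu>])
    show "\<mu> B \<le> \<mu> C" if "B \<in> \<D>" "C \<in> \<D>" "B \<subseteq> C" for B C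
    proof -
      have "B \<in> sets M" "C \<in> sets M" "C - B \<in> sets M" "positive_on M \<mu> C"
        using that by (auto simp: \<D>_def)
      moreover from this have "0 \<le> \<mu> (C - B)" by (simp add: positive_on_def)
      ultimately show ?thesis using *[of B C] that(3) by simp
    qed
  qed
  then obtain H where H: "H \<in> \<D>" "\<And>C. C \<in> \<D> \<Longrightarrow> \<mu> C \<le> \<mu> H" by blast
  show ?thesis
  proof (rule that[of H])
    show HM: "H \<in> sets M" and HP: "positive_on M \<mu> H" using H by (auto simp: \<D>_def)
    fix B assume B: "B \<in> sets M" "B \<inter> H = {}"
    obtain P where P: "P \<in> sets M" "P \<subseteq> B" "positive_on M \<mu> P" "\<mu> B \<le> \<mu> P"
      using ca_positive_subset[OF \<mu> B(1)] by blast
    \<comment> \<open>The sequence \<open>H, P, P, ...\<close> presents the union of two sets as a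
      countable one.\<close>
    have "positive_on M \<mu> (\<Union>n. if n = (0::nat) then H else P)"
      using HM HP P by (intro positive_on_UN[OF \<mu>]) auto
    moreover have "(\<Union>n. if n = (0::nat) then H else P) = H \<union> P"
      by (auto split: if_splits)
    ultimately have "\<mu> (H \<union> P) \<le> \<mu> H" using HM P by (intro H) (auto simp: \<D>_def)
    moreover have "\<mu> (H \<union> P) = \<mu> H + \<mu> P" using HM P B by (intro ca_Un[OF \<mu>]) auto
    ultimately show "\<mu> B \<le> 0" using P by simp
  qed
qed

text \<open>Weaker than a measure on purpose: finite values and finite additivity give monotonicity
  for \<open>exhaustion\<close>, and both pass at once to sums and to a sub-sigma-algebra.\<close>

definition finite_content :: "'a measure \<Rightarrow> ('a set \<Rightarrow> real) \<Rightarrow> bool" where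
  "finite_content M v \<longleftrightarrow> (\<forall>A\<in>sets M. 0 \<le> v A) \<and>
     (\<forall>A\<in>sets M. \<forall>B\<in>sets M. A \<inter> B = {} \<longrightarrow> v (A \<union> B) = v A + v B)"

text \<open>The content is the variation of \<open>\<mu>\<close> written with a Hahn set, so its
  values are real by construction.\<close>

lemma ca_finite_content:
  assumes \<mu>: "\<mu> \<in> ca M"
  obtains v where "finite_content M v"
    "\<And>A. A \<in> sets M \<Longrightarrow> v A = 0 \<Longrightarrow> total_variation M \<mu> A = 0"
proof -
  obtain H where H: "H \<in> sets M" "positive_on M \<mu> H"
    "\<And>B. B \<in> sets M \<Longrightarrow> B \<inter> H = {} \<Longrightarrow> \<mu> B \<le> 0"
    using Hahn_decomposition_ca[OF \<mu>] by blast
  define v where "v A = \<mu> (A \<inter> H) - \<mu> (A - H)" for A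
  have pos: "0 \<le> \<mu> (A \<inter> H)" "\<mu> (A - H) \<le> 0" if "A \<in> sets M" for A
    using H(1,2) that H(3)[of "A - H"] by (auto simp: positive_on_def)
  show ?thesis
  proof (rule that[of v])
    have "v (A \<union> B) = v A + v B" if AB: "A \<in> sets M" "B \<in> sets M" "A \<inter> B = {}" for A B
    proof -
      have "\<mu> ((A \<union> B) \<inter> H) = \<mu> (A \<inter> H) + \<mu> (B \<inter> H)"
        unfolding Int_Un_distrib2 using AB H by (intro ca_Un[OF \<mu>]) auto
      moreover have "\<mu> ((A \<union> B) - H) = \<mu> (A - H) + \<mu> (B - H)"
        unfolding Un_Diff using AB H by (intro ca_Un[OF \<mu>]) auto
      ultimately show ?thesis by (simp add: v_def)
    qed
    moreover have "0 \<le> v A" if "A \<in> sets M" for A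
      using pos[OF that] by (simp add: v_def)
    ultimately show "finite_content M v" by (simp add: finite_content_def)
    fix A assume A: "A \<in> sets M" "v A = 0"
    then have 0: "\<mu> (A \<inter> H) = 0" "\<mu> (A - H) = 0" using pos[OF A(1)] by (auto simp: v_def)
    \<comment> \<open>On \<open>H\<close> all values are nonnegative and off \<open>H\<close> all
      are nonpositive, so a total of 0 on each side leaves no room for cancellation between
      \<open>B\<close> and \<open>A - B\<close>.\<close>
    have "\<mu> B = 0" if B: "B \<in> sets M" "B \<subseteq> A" for B
    proof -
      have "\<mu> (A \<inter> H) = \<mu> (B \<inter> H) + \<mu> ((A - B) \<inter> H)"
      proof -
        have "(A \<inter> H) \<inter> B = B \<inter> H" "(A \<inter> H) - B = (A - B) \<inter> H" using B by auto
        then show ?thesis using ca_split[OF \<mu>, of "A \<inter> H" B] A B H by simp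
      qed
      moreover have "\<mu> (A - H) = \<mu> (B - H) + \<mu> ((A - B) - H)"
      proof -
        have "(A - H) \<inter> B = B - H" "(A - H) - B = (A - B) - H" using B by auto
        then show ?thesis using ca_split[OF \<mu>, of "A - H" B] A B H by simp
      qed
      moreover have "\<mu> B = \<mu> (B \<inter> H) + \<mu> (B - H)" using ca_split[OF \<mu>] B H by blast
      moreover have "A - B \<in> sets M" using A B by auto
      ultimately show ?thesis using 0 pos[OF B(1)] pos[of "A - B"] by linarith
    qed
    then show "total_variation M \<mu> A = 0" using total_variation_eq_0_iff[OF \<mu> A(1)] by blast
  qed
qed

section \<open>Quasi-sure properties\<close>

lemma upper_prob_eq_0_iff: "upper_prob \<PP> A = 0 \<longleftrightarrow> (\<forall>P\<in>\<PP>. emeasure P A = 0)"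
  unfolding upper_prob_def bot_ennreal[symmetric] by (rule SUP_bot_conv)

lemma SUP_total_variation:
  assumes "\<PP> \<subseteq> prob_measures M" "N \<in> sets M"
  shows "(SUP \<nu>\<in>measure ` \<PP>. total_variation M \<nu> N) = upper_prob \<PP> N"
  unfolding upper_prob_def image_image
  using assms by (intro SUP_cong refl total_variation_measure) auto

lemma equiv_sets_measure_iff:
  assumes "\<PP> \<subseteq> prob_measures M" "\<QQ> \<subseteq> prob_measures M"
  shows "equiv_sets M (measure ` \<PP>) (measure ` \<QQ>) \<longleftrightarrow>
    (\<forall>N\<in>sets M. upper_prob \<PP> N = 0 \<longleftrightarrow> upper_prob \<QQ> N = 0)"
  using assms by (auto simp: equiv_sets_def dominated_by_def SUP_total_variation)

lemma ca_c_null: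
  assumes "\<PP> \<subseteq> prob_measures M" "\<mu> \<in> ca_c M \<PP>" "N \<in> sets M" "upper_prob \<PP> N = 0"
  shows "total_variation M \<mu> N = 0"
  using assms by (auto simp: ca_c_def dominated_by_def SUP_total_variation)

lemma total_variation_0_mono:
  assumes "\<mu> \<in> ca M" "A \<in> sets M" "B \<in> sets M" "B \<subseteq> A" "total_variation M \<mu> A = 0"
  shows "total_variation M \<mu> B = 0" "\<mu> B = 0"
  using assms by (auto simp: total_variation_eq_0_iff)

lemma qs_AE:
  assumes "\<PP> \<subseteq> prob_measures M" "qs M \<PP> \<phi>" "P \<in> \<PP>"
  shows "AE \<omega> in P. \<phi> \<omega>"
proof -
  obtain N where N: "N \<in> sets M" "upper_prob \<PP> N = 0" "\<forall>\<omega>\<in>space M - N. \<phi> \<omega>"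
    using assms unfolding qs_def by blast
  have "sets P = sets M" using assms by (auto simp: prob_measures_def)
  then have "N \<in> null_sets P" "space P = space M"
    using N assms sets_eq_imp_space_eq[of P M] by (auto simp: upper_prob_eq_0_iff)
  then show ?thesis using N by (intro AE_I'[of N]) auto
qed

text \<open>Almost sure statements come with an exceptional set for each measure. Measurability of
  the set where \<open>\<phi>\<close> holds makes its complement a common exceptional event.\<close>

lemma qsI_AE:
  assumes \<PP>: "\<PP> \<subseteq> prob_measures M" and \<phi>: "{\<omega> \<in> space M. \<phi> \<omega>} \<in> sets M"
    and AE: "\<And>P. P \<in> \<PP> \<Longrightarrow> AE \<omega> in P. \<phi> \<omega>"
  shows "qs M \<PP> \<phi>"
proof -
  have eq: "{\<omega> \<in> space M. \<not> \<phi> \<omega>} = space M - {\<omega> \<in> space M. \<phi> \<omega>}" by auto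
  have N: "{\<omega> \<in> space M. \<not> \<phi> \<omega>} \<in> sets M" unfolding eq using \<phi> by (rule sets.compl_sets)
  have "emeasure P {\<omega> \<in> space M. \<not> \<phi> \<omega>} = 0" if P: "P \<in> \<PP>" for P
  proof -
    have sP: "sets P = sets M" using P \<PP> by (auto simp: prob_measures_def)
    show ?thesis
      using AE[OF P] N AE_iff_measurable[of "{\<omega> \<in> space M. \<not> \<phi> \<omega>}" P \<phi>]
      by (simp add: sP sets_eq_imp_space_eq[OF sP])
  qed
  then show ?thesis
    unfolding qs_def using N by (intro bexI[of _ "{\<omega> \<in> space M. \<not> \<phi> \<omega>}"]) (auto simp: upper_prob_eq_0_iff)
qed

text \<open>The exceptional event on the left may differ from \<open>N\<close>, but it contains
  \<open>N\<close> up to points outside the space, so each measure gives \<open>N\<close> mass 0.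
  Null events thus become quasi-sure statements, to be combined by \<open>qs_conj\<close> and
  \<open>qs_mono\<close> without set computations.\<close>

lemma qs_notin_iff:
  assumes "\<PP> \<subseteq> prob_measures M" "N \<in> sets M"
  shows "qs M \<PP> (\<lambda>\<omega>. \<omega> \<notin> N) \<longleftrightarrow> upper_prob \<PP> N = 0"
proof
  assume qs: "qs M \<PP> (\<lambda>\<omega>. \<omega> \<notin> N)"
  have "emeasure P N = 0" if P: "P \<in> \<PP>" for P
  proof -
    have "sets P = sets M" using P assms by (auto simp: prob_measures_def)
    moreover have "N = {\<omega> \<in> space P. \<omega> \<in> N}"
      using sets.sets_into_space[OF assms(2)] sets_eq_imp_space_eq[OF \<open>sets P = sets M\<close>] by auto
    ultimately show ?thesis
      using qs_AE[OF assms(1) qs P] assms(2) AE_iff_measurable[of N P "\<lambda>\<omega>. \<omega> \<notin> N"] by simp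
  qed
  then show "upper_prob \<PP> N = 0" by (simp add: upper_prob_eq_0_iff)
qed (use assms in \<open>auto simp: qs_def\<close>)

lemma qs_all:
  assumes \<PP>: "\<PP> \<subseteq> prob_measures M" and qs: "\<And>n::nat. qs M \<PP> (\<phi> n)"
  shows "qs M \<PP> (\<lambda>\<omega>. \<forall>n. \<phi> n \<omega>)"
proof -
  obtain N where N: "\<And>n. N n \<in> sets M" "\<And>n. upper_prob \<PP> (N n) = 0"
      "\<And>n. \<forall>\<omega>\<in>space M - N n. \<phi> n \<omega>"
    using qs unfolding qs_def by metis
  have "emeasure P (\<Union>n. N n) = 0" if P: "P \<in> \<PP>" for P
  proof -
    have "sets P = sets M" using P \<PP> by (auto simp: prob_measures_def)
    then have "(\<Union>n. N n) \<in> null_sets P"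
      using N P by (intro null_sets_UN) (auto simp: upper_prob_eq_0_iff)
    then show ?thesis by auto
  qed
  then show ?thesis
    unfolding qs_def using N by (intro bexI[of _ "\<Union>n. N n"]) (auto simp: upper_prob_eq_0_iff)
qed

text \<open>Both differences are null for the upper probability, hence for the total variation by
  domination. This carries values between the two sigma-algebras.\<close>

lemma ca_c_cong_qs:
  assumes \<PP>: "\<PP> \<subseteq> prob_measures M" and \<mu>: "\<mu> \<in> ca_c M \<PP>" and AB: "A \<in> sets M" "B \<in> sets M"
    and qs: "qs M \<PP> (\<lambda>\<omega>. \<omega> \<in> A \<longleftrightarrow> \<omega> \<in> B)"
  shows "\<mu> A = \<mu> B"
proof -
  have \<mu>': "\<mu> \<in> ca M" using \<mu> by (simp add: ca_c_def)
  have "\<mu> (C - D) = 0" if "C \<in> sets M" "D \<in> sets M" "qs M \<PP> (\<lambda>\<omega>. \<omega> \<in> C \<longleftrightarrow> \<omega> \<in> D)" for C D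
  proof -
    have "qs M \<PP> (\<lambda>\<omega>. \<omega> \<notin> C - D)" using that(3) by (rule qs_mono) auto
    then have "total_variation M \<mu> (C - D) = 0"
      using that(1,2) qs_notin_iff[OF \<PP>, of "C - D"] by (intro ca_c_null[OF \<PP> \<mu>]) auto
    then show ?thesis using \<mu>' that(1,2) by (auto simp: total_variation_eq_0_iff)
  qed
  from this[OF AB qs] this[OF AB(2,1) qs_mono[OF qs]] have "\<mu> (A - B) = 0" "\<mu> (B - A) = 0"
    by auto
  then show ?thesis
    using ca_split[OF \<mu>' AB] ca_split[OF \<mu>' AB(2,1)] by (simp add: Int_commute[of B A])
qed

section \<open>The lattice of bounded classes\<close>

lemma qs_class_eq_iff:
  assumes "\<PP> \<subseteq> prob_measures M" "f \<in> borel_measurable M" "g \<in> borel_measurable M"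
  shows "qs_class M \<PP> f = qs_class M \<PP> g \<longleftrightarrow> qs M \<PP> (\<lambda>\<omega>. f \<omega> = g \<omega>)"
  unfolding qs_class_def using eq_equiv_class_iff[OF equiv_qs_eq_rel[OF assms(1)] assms(2,3)] assms
  by (auto simp: qs_eq_rel_def)

lemma qs_class_self:
  assumes "\<PP> \<subseteq> prob_measures M" "f \<in> borel_measurable M"
  shows "f \<in> qs_class M \<PP> f"
  unfolding qs_class_def using equiv_class_self[OF equiv_qs_eq_rel[OF assms(1)] assms(2)] .

lemma in_qs_class_iff:
  "g \<in> qs_class M \<PP> f \<longleftrightarrow>
     f \<in> borel_measurable M \<and> g \<in> borel_measurable M \<and> qs M \<PP> (\<lambda>\<omega>. f \<omega> = g \<omega>)"
  by (auto simp: qs_class_def qs_eq_rel_def)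

lemma vle_L0_qs_class:
  assumes \<PP>: "\<PP> \<subseteq> prob_measures M" and fg: "f \<in> borel_measurable M" "g \<in> borel_measurable M"
  shows "vle (L0 M \<PP>) (qs_class M \<PP> f) (qs_class M \<PP> g) \<longleftrightarrow> qs M \<PP> (\<lambda>\<omega>. f \<omega> \<le> g \<omega>)"
proof
  assume "vle (L0 M \<PP>) (qs_class M \<PP> f) (qs_class M \<PP> g)"
  then obtain f' g' where *: "qs M \<PP> (\<lambda>\<omega>. f \<omega> = f' \<omega>)" "qs M \<PP> (\<lambda>\<omega>. g \<omega> = g' \<omega>)"
      "qs M \<PP> (\<lambda>\<omega>. f' \<omega> \<le> g' \<omega>)"
    by (auto simp: L0_def in_qs_class_iff)
  show "qs M \<PP> (\<lambda>\<omega>. f \<omega> \<le> g \<omega>)"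
    using qs_conj[OF \<PP> *(1) qs_conj[OF \<PP> *(2,3)]] by (rule qs_mono) auto
next
  assume "qs M \<PP> (\<lambda>\<omega>. f \<omega> \<le> g \<omega>)"
  then show "vle (L0 M \<PP>) (qs_class M \<PP> f) (qs_class M \<PP> g)"
    using qs_class_self[OF \<PP>] fg by (auto simp: L0_def)
qed

lemma vle_Linf_qs_class:
  assumes "\<PP> \<subseteq> prob_measures M" "f \<in> borel_measurable M" "g \<in> borel_measurable M"
  shows "vle (Linf M \<PP>) (qs_class M \<PP> f) (qs_class M \<PP> g) \<longleftrightarrow> qs M \<PP> (\<lambda>\<omega>. f \<omega> \<le> g \<omega>)"
  using vle_L0_qs_class[OF assms] by (simp add: Linf_def)

lemma vzero_Linf: "vzero (Linf M \<PP>) = qs_class M \<PP> (\<lambda>_. 0)"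
  by (simp add: Linf_def L0_def)

lemma vadd_Linf_qs_class:
  assumes "\<PP> \<subseteq> prob_measures M" "f \<in> borel_measurable M" "g \<in> borel_measurable M"
  shows "vadd (Linf M \<PP>) (qs_class M \<PP> f) (qs_class M \<PP> g) = qs_class M \<PP> (\<lambda>\<omega>. f \<omega> + g \<omega>)"
  using L0_vadd_class[OF assms] by (simp add: Linf_def)

text \<open>Operations on classes are unions over all representatives; for a pointwise operation
  \<open>T\<close> the union collapses to a single class. It serves scaling as well as
  \<open>L0_abs\<close>.\<close>

lemma UN_qs_class:
  assumes \<PP>: "\<PP> \<subseteq> prob_measures M" and f: "f \<in> borel_measurable M"
    and T: "\<And>g. g \<in> borel_measurable M \<Longrightarrow> T \<circ> g \<in> borel_measurable M"
  shows "(\<Union>g\<in>qs_class M \<PP> f. qs_class M \<PP> (\<lambda>\<omega>. T (g \<omega>))) = qs_class M \<PP> (\<lambda>\<omega>. T (f \<omega>))"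
proof -
  have "qs_class M \<PP> (\<lambda>\<omega>. T (g \<omega>)) = qs_class M \<PP> (\<lambda>\<omega>. T (f \<omega>))" if "g \<in> qs_class M \<PP> f" for g
  proof -
    have "qs M \<PP> (\<lambda>\<omega>. f \<omega> = g \<omega>)" "g \<in> borel_measurable M"
      using that by (auto simp: in_qs_class_iff)
    moreover from this(1) have "qs M \<PP> (\<lambda>\<omega>. T (g \<omega>) = T (f \<omega>))" by (rule qs_mono) simp
    ultimately show ?thesis using T[of f] T[of g] f \<PP> by (simp add: qs_class_eq_iff comp_def)
  qed
  then show ?thesis using qs_class_self[OF \<PP> f] by blast
qed

lemma vscale_Linf_qs_class:
  assumes "\<PP> \<subseteq> prob_measures M" "f \<in> borel_measurable M"
  shows "vscale (Linf M \<PP>) a (qs_class M \<PP> f) = qs_class M \<PP> (\<lambda>\<omega>. a * f \<omega>)"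
  using UN_qs_class[OF assms, of "\<lambda>x. a * x"] by (simp add: Linf_def L0_def comp_def)

lemma qs_class_in_Linf:
  assumes \<PP>: "\<PP> \<subseteq> prob_measures M" and f: "f \<in> borel_measurable M" "\<And>\<omega>. \<bar>f \<omega>\<bar> \<le> m"
  shows "qs_class M \<PP> f \<in> elems (Linf M \<PP>)"
proof -
  have abs: "L0_abs M \<PP> (qs_class M \<PP> f) = qs_class M \<PP> (\<lambda>\<omega>. \<bar>f \<omega>\<bar>)"
    unfolding L0_abs_def by (rule UN_qs_class[OF \<PP> f(1)]) (simp add: comp_def)
  have "qs M \<PP> (\<lambda>\<omega>. \<bar>f \<omega>\<bar> \<le> \<bar>m\<bar> + 1)"
    unfolding qs_def using order_trans[OF f(2)] by (intro bexI[of _ "{}"]) (auto simp: upper_prob_eq_0_iff)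
  then have "vle (L0 M \<PP>) (L0_abs M \<PP> (qs_class M \<PP> f)) (qs_class M \<PP> (\<lambda>_. \<bar>m\<bar> + 1))"
    using f(1) \<PP> by (simp add: abs vle_L0_qs_class)
  moreover have "qs_class M \<PP> f \<in> elems (L0 M \<PP>)"
    using f(1) by (auto simp: L0_def qs_class_def intro: quotientI)
  ultimately show ?thesis
    by (auto simp: Linf_def intro!: exI[of _ "\<bar>m\<bar> + 1"])
qed

text \<open>Truncation at the quasi-sure bound yields a representative bounded at every point, so
  later bounds can be argued pointwise without exceptional sets.\<close>

lemma Linf_elemE:
  assumes \<PP>: "\<PP> \<subseteq> prob_measures M" and X: "X \<in> elems (Linf M \<PP>)"
  obtains f m where "f \<in> borel_measurable M" "m > 0" "\<And>\<omega>. \<bar>f \<omega>\<bar> \<le> m" "X = qs_class M \<PP> f"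
proof -
  obtain g where g: "g \<in> borel_measurable M" "X = qs_class M \<PP> g"
    using X by (auto simp: Linf_def L0_def qs_class_def elim: quotientE)
  have abs: "L0_abs M \<PP> (qs_class M \<PP> g) = qs_class M \<PP> (\<lambda>\<omega>. \<bar>g \<omega>\<bar>)"
    unfolding L0_abs_def by (rule UN_qs_class[OF \<PP> g(1)]) (simp add: comp_def)
  obtain m where m: "m > 0" "vle (L0 M \<PP>) (L0_abs M \<PP> X) (qs_class M \<PP> (\<lambda>_. m))"
    using X by (auto simp: Linf_def)
  then have "qs M \<PP> (\<lambda>\<omega>. \<bar>g \<omega>\<bar> \<le> m)"
    using g \<PP> by (simp add: abs vle_L0_qs_class)
  then have "qs M \<PP> (\<lambda>\<omega>. g \<omega> = max (- m) (min m (g \<omega>)))"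
    by (rule qs_mono) auto
  then have "X = qs_class M \<PP> (\<lambda>\<omega>. max (- m) (min m (g \<omega>)))"
    using g \<PP> by (simp add: qs_class_eq_iff)
  then show ?thesis
    using m(1) g(1) by (intro that[of "\<lambda>\<omega>. max (- m) (min m (g \<omega>))" m]) auto
qed

lemma Linf_antisym:
  assumes \<PP>: "\<PP> \<subseteq> prob_measures M" and XY: "X \<in> elems (Linf M \<PP>)" "Y \<in> elems (Linf M \<PP>)"
    and le: "vle (Linf M \<PP>) X Y" "vle (Linf M \<PP>) Y X"
  shows "X = Y"
proof -
  obtain f g where fg: "f \<in> borel_measurable M" "X = qs_class M \<PP> f" "g \<in> borel_measurable M" "Y = qs_class M \<PP> g"
    using Linf_elemE[OF \<PP>] XY by metis
  then have "qs M \<PP> (\<lambda>\<omega>. f \<omega> \<le> g \<omega>)" "qs M \<PP> (\<lambda>\<omega>. g \<omega> \<le> f \<omega>)"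
    using le \<PP> by (simp_all add: vle_Linf_qs_class)
  from qs_conj[OF \<PP> this] have "qs M \<PP> (\<lambda>\<omega>. f \<omega> = g \<omega>)" by (rule qs_mono) auto
  then show ?thesis using fg \<PP> by (simp add: qs_class_eq_iff)
qed

lemma is_supremum_Linf_unique:
  assumes "\<PP> \<subseteq> prob_measures M" "is_supremum (Linf M \<PP>) A s" "is_supremum (Linf M \<PP>) A s'"
  shows "s = s'"
  using assms(2,3) by (intro Linf_antisym[OF assms(1)]) (auto simp: is_supremum_def)

lemma is_infimum_Linf_unique:
  assumes "\<PP> \<subseteq> prob_measures M" "is_infimum (Linf M \<PP>) A s" "is_infimum (Linf M \<PP>) A s'"
  shows "s = s'"
  using assms(2,3) by (intro Linf_antisym[OF assms(1)]) (auto simp: is_infimum_def)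

lemma qs_everywhere: "(\<And>\<omega>. \<omega> \<in> space M \<Longrightarrow> \<phi> \<omega>) \<Longrightarrow> qs M \<PP> \<phi>"
  by (auto simp: qs_def upper_prob_eq_0_iff intro!: bexI[of _ "{}"])

text \<open>Stated as an equivalence because \<open>lattice_hom\<close> quantifies over every
  \<open>s\<close> that is a supremum of two elements; in this form it rewrites the condition into
  one on representatives.\<close>

lemma is_supremum_Linf_max:
  assumes \<PP>: "\<PP> \<subseteq> prob_measures M" and fg: "f \<in> borel_measurable M" "g \<in> borel_measurable M"
    and bd: "\<And>\<omega>. \<bar>f \<omega>\<bar> \<le> m" "\<And>\<omega>. \<bar>g \<omega>\<bar> \<le> n"
  shows "is_supremum (Linf M \<PP>) {qs_class M \<PP> f, qs_class M \<PP> g} s \<longleftrightarrow>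
    s = qs_class M \<PP> (\<lambda>\<omega>. max (f \<omega>) (g \<omega>))"
proof -
  have mx: "(\<lambda>\<omega>. max (f \<omega>) (g \<omega>)) \<in> borel_measurable M" using fg by simp
  have "\<bar>max (f \<omega>) (g \<omega>)\<bar> \<le> max m n" for \<omega> using bd[of \<omega>] by linarith
  then have "qs_class M \<PP> (\<lambda>\<omega>. max (f \<omega>) (g \<omega>)) \<in> elems (Linf M \<PP>)"
    by (rule qs_class_in_Linf[OF \<PP> mx])
  moreover have "vle (Linf M \<PP>) (qs_class M \<PP> (\<lambda>\<omega>. max (f \<omega>) (g \<omega>))) u"
    if u: "u \<in> elems (Linf M \<PP>)" "vle (Linf M \<PP>) (qs_class M \<PP> f) u" "vle (Linf M \<PP>) (qs_class M \<PP> g) u" for u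
  proof -
    obtain h where h: "h \<in> borel_measurable M" "u = qs_class M \<PP> h" using Linf_elemE[OF \<PP> u(1)] by metis
    then have "qs M \<PP> (\<lambda>\<omega>. f \<omega> \<le> h \<omega>)" "qs M \<PP> (\<lambda>\<omega>. g \<omega> \<le> h \<omega>)"
      using u fg \<PP> by (simp_all add: vle_Linf_qs_class)
    from qs_conj[OF \<PP> this] have "qs M \<PP> (\<lambda>\<omega>. max (f \<omega>) (g \<omega>) \<le> h \<omega>)" by (rule qs_mono) auto
    then show ?thesis using h mx \<PP> by (simp add: vle_Linf_qs_class)
  qed
  ultimately have "is_supremum (Linf M \<PP>) {qs_class M \<PP> f, qs_class M \<PP> g} (qs_class M \<PP> (\<lambda>\<omega>. max (f \<omega>) (g \<omega>)))"
    using fg mx \<PP> by (auto simp: is_supremum_def vle_Linf_qs_class intro!: qs_everywhere)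
  then show ?thesis
    using is_supremum_Linf_unique[OF \<PP>] by blast
qed

lemma is_infimum_Linf_min:
  assumes \<PP>: "\<PP> \<subseteq> prob_measures M" and fg: "f \<in> borel_measurable M" "g \<in> borel_measurable M"
    and bd: "\<And>\<omega>. \<bar>f \<omega>\<bar> \<le> m" "\<And>\<omega>. \<bar>g \<omega>\<bar> \<le> n"
  shows "is_infimum (Linf M \<PP>) {qs_class M \<PP> f, qs_class M \<PP> g} s \<longleftrightarrow>
    s = qs_class M \<PP> (\<lambda>\<omega>. min (f \<omega>) (g \<omega>))"
proof -
  have mn: "(\<lambda>\<omega>. min (f \<omega>) (g \<omega>)) \<in> borel_measurable M" using fg by simp
  have "\<bar>min (f \<omega>) (g \<omega>)\<bar> \<le> max m n" for \<omega> using bd[of \<omega>] by linarith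
  then have "qs_class M \<PP> (\<lambda>\<omega>. min (f \<omega>) (g \<omega>)) \<in> elems (Linf M \<PP>)"
    by (rule qs_class_in_Linf[OF \<PP> mn])
  moreover have "vle (Linf M \<PP>) u (qs_class M \<PP> (\<lambda>\<omega>. min (f \<omega>) (g \<omega>)))"
    if u: "u \<in> elems (Linf M \<PP>)" "vle (Linf M \<PP>) u (qs_class M \<PP> f)" "vle (Linf M \<PP>) u (qs_class M \<PP> g)" for u
  proof -
    obtain h where h: "h \<in> borel_measurable M" "u = qs_class M \<PP> h" using Linf_elemE[OF \<PP> u(1)] by metis
    then have "qs M \<PP> (\<lambda>\<omega>. h \<omega> \<le> f \<omega>)" "qs M \<PP> (\<lambda>\<omega>. h \<omega> \<le> g \<omega>)"
      using u fg \<PP> by (simp_all add: vle_Linf_qs_class)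
    from qs_conj[OF \<PP> this] have "qs M \<PP> (\<lambda>\<omega>. h \<omega> \<le> min (f \<omega>) (g \<omega>))" by (rule qs_mono) auto
    then show ?thesis using h mn \<PP> by (simp add: vle_Linf_qs_class)
  qed
  ultimately have "is_infimum (Linf M \<PP>) {qs_class M \<PP> f, qs_class M \<PP> g} (qs_class M \<PP> (\<lambda>\<omega>. min (f \<omega>) (g \<omega>)))"
    using fg mn \<PP> by (auto simp: is_infimum_def vle_Linf_qs_class intro!: qs_everywhere)
  then show ?thesis
    using is_infimum_Linf_unique[OF \<PP>] by blast
qed

lemma J_map_lattice_hom:
  assumes enl: "enlargement M \<PP> G \<PP>'" and \<PP>: "\<PP> \<subseteq> prob_measures M"
  shows "lattice_hom (Linf M \<PP>) (Linf G \<PP>') (J_map G \<PP>')"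
proof -
  have sub: "subalgebra G M" and \<PP>': "\<PP>' \<subseteq> prob_measures G" using enl by (auto simp: enlargement_def)
  note J = J_map_qs_class[OF enl \<PP>]
  have meas: "f \<in> borel_measurable G" if "f \<in> borel_measurable M" for f :: "'a \<Rightarrow> real"
    using that sub by (auto intro: measurable_from_subalg)
  have "J_map G \<PP>' X \<in> elems (Linf G \<PP>')" if X: "X \<in> elems (Linf M \<PP>)" for X
  proof -
    obtain f m where f: "f \<in> borel_measurable M" "\<And>\<omega>. \<bar>f \<omega>\<bar> \<le> m" "X = qs_class M \<PP> f"
      using Linf_elemE[OF \<PP> X] by blast
    then show ?thesis using qs_class_in_Linf[OF \<PP>' meas[OF f(1)] f(2)] by (simp add: J)
  qed
  moreover have "J_map G \<PP>' (vadd (Linf M \<PP>) X Y) = vadd (Linf G \<PP>') (J_map G \<PP>' X) (J_map G \<PP>' Y) \<and>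
      (\<forall>s. is_supremum (Linf M \<PP>) {X, Y} s \<longrightarrow>
        is_supremum (Linf G \<PP>') {J_map G \<PP>' X, J_map G \<PP>' Y} (J_map G \<PP>' s)) \<and>
      (\<forall>s. is_infimum (Linf M \<PP>) {X, Y} s \<longrightarrow>
        is_infimum (Linf G \<PP>') {J_map G \<PP>' X, J_map G \<PP>' Y} (J_map G \<PP>' s))"
    if X: "X \<in> elems (Linf M \<PP>)" and Y: "Y \<in> elems (Linf M \<PP>)" for X Y
  proof -
    obtain f m where f: "f \<in> borel_measurable M" "\<And>\<omega>. \<bar>f \<omega>\<bar> \<le> m" "X = qs_class M \<PP> f"
      using Linf_elemE[OF \<PP> X] by blast
    obtain g n where g: "g \<in> borel_measurable M" "\<And>\<omega>. \<bar>g \<omega>\<bar> \<le> n" "Y = qs_class M \<PP> g"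
      using Linf_elemE[OF \<PP> Y] by blast
    show ?thesis
      using f(1) g(1)
      by (simp add: f(3) g(3) J meas vadd_Linf_qs_class \<PP> \<PP>'
          is_supremum_Linf_max[OF \<PP> f(1) g(1) f(2) g(2)] is_infimum_Linf_min[OF \<PP> f(1) g(1) f(2) g(2)]
          is_supremum_Linf_max[OF \<PP>' meas[OF f(1)] meas[OF g(1)] f(2) g(2)]
          is_infimum_Linf_min[OF \<PP>' meas[OF f(1)] meas[OF g(1)] f(2) g(2)])
  qed
  moreover have "J_map G \<PP>' (vscale (Linf M \<PP>) a X) = vscale (Linf G \<PP>') a (J_map G \<PP>' X)"
    if X: "X \<in> elems (Linf M \<PP>)" for a X
  proof -
    obtain f where f: "f \<in> borel_measurable M" "X = qs_class M \<PP> f"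
      using Linf_elemE[OF \<PP> X] by metis
    then show ?thesis by (simp add: J meas vscale_Linf_qs_class \<PP> \<PP>')
  qed
  ultimately show ?thesis unfolding lattice_hom_def by blast
qed


section \<open>Order dense enlargements\<close>

text \<open>Order density reduced to indicator functions. The inclusion of \<open>B\<close> in
  \<open>A\<close> is quasi sure because a class determines an event only up to null sets.\<close>

locale dense_enlargement =
  fixes M G :: "'a measure" and \<PP> \<PP>' :: "'a measure set"
  assumes sub: "subalgebra G M"
    and prob: "\<PP> \<subseteq> prob_measures M" and prob': "\<PP>' \<subseteq> prob_measures G"
    and null_iff: "N \<in> sets M \<Longrightarrow> upper_prob \<PP>' N = 0 \<longleftrightarrow> upper_prob \<PP> N = 0"
    and dense: "A \<in> sets G \<Longrightarrow> upper_prob \<PP>' A \<noteq> 0 \<Longrightarrow>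
      \<exists>B\<in>sets M. upper_prob \<PP>' B \<noteq> 0 \<and> qs G \<PP>' (\<lambda>\<omega>. \<omega> \<in> B \<longrightarrow> \<omega> \<in> A)"
begin

lemma space_eq: "space G = space M"
  using sub by (simp add: subalgebra_def)

lemma sets_G: "A \<in> sets M \<Longrightarrow> A \<in> sets G"
  using sub by (auto simp: subalgebra_def)

lemmas qs_conj' = qs_conj[OF prob'] and qs_notin_iff' = qs_notin_iff[OF prob']

section \<open>Replacing events of the enlargement by original events\<close>

lemma null_iff_qs: "A \<in> sets M \<Longrightarrow> upper_prob \<PP> A = 0 \<longleftrightarrow> qs G \<PP>' (\<lambda>\<omega>. \<omega> \<notin> A)"
  using null_iff qs_notin_iff' sets_G by simp

text \<open>The exceptional event on the left lies in \<open>G\<close>, but it may be exchanged for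
  the symmetric difference, which lies in \<open>M\<close>, where null events agree.\<close>

lemma qs_M_eq:
  assumes "A \<in> sets M" "B \<in> sets M" "qs G \<PP>' (\<lambda>\<omega>. \<omega> \<in> A \<longleftrightarrow> \<omega> \<in> B)"
  shows "qs M \<PP> (\<lambda>\<omega>. \<omega> \<in> A \<longleftrightarrow> \<omega> \<in> B)"
proof -
  have "qs G \<PP>' (\<lambda>\<omega>. \<omega> \<notin> (A - B) \<union> (B - A))" using assms(3) by (rule qs_mono) auto
  moreover have "(A - B) \<union> (B - A) \<in> sets M" using assms by auto
  ultimately have "qs M \<PP> (\<lambda>\<omega>. \<omega> \<notin> (A - B) \<union> (B - A))"
    using qs_notin_iff[OF prob] null_iff_qs by blast
  then show ?thesis by (rule qs_mono) auto
qed

text \<open>Hypothesis \<open>pos\<close> lets \<open>v\<close> detect every non-null event of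
  \<open>M\<close> inside \<open>A\<close>, which is what a support provides. Keeping
  \<open>v\<close> abstract covers both a single measure with support in \<open>M\<close> and a pair
  of measures whose supports lie only in \<open>G\<close>.\<close>

lemma ex_qs_eq:
  assumes v: "finite_content M v" and A: "A \<in> sets G"
    and pos: "\<And>C. C \<in> sets M \<Longrightarrow> qs G \<PP>' (\<lambda>\<omega>. \<omega> \<in> C \<longrightarrow> \<omega> \<in> A) \<Longrightarrow> v C = 0 \<Longrightarrow>
      qs G \<PP>' (\<lambda>\<omega>. \<omega> \<notin> C)"
  shows "\<exists>B\<in>sets M. qs G \<PP>' (\<lambda>\<omega>. \<omega> \<in> A \<longleftrightarrow> \<omega> \<in> B)"
proof -
  define \<D> where "\<D> = {B \<in> sets M. qs G \<PP>' (\<lambda>\<omega>. \<omega> \<in> B \<longrightarrow> \<omega> \<in> A)}"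
  have "\<exists>B\<in>\<D>. \<forall>C\<in>\<D>. v C \<le> v B"
  proof (rule exhaustion)
    show "\<D> \<noteq> {}" by (auto simp: \<D>_def qs_def upper_prob_eq_0_iff intro!: exI[of _ "{}"] bexI[of _ "{}"])
    show "(\<Union>n. B n) \<in> \<D>" if B: "range B \<subseteq> \<D>" for B :: "nat \<Rightarrow> 'a set"
    proof -
      have "qs G \<PP>' (\<lambda>\<omega>. \<forall>n. \<omega> \<in> B n \<longrightarrow> \<omega> \<in> A)"
        using B by (intro qs_all[OF prob']) (auto simp: \<D>_def)
      then have "qs G \<PP>' (\<lambda>\<omega>. \<omega> \<in> (\<Union>n. B n) \<longrightarrow> \<omega> \<in> A)" by (rule qs_mono) auto
      then show ?thesis using B by (auto simp: \<D>_def)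
    qed
    show "v B \<le> v C" if "B \<in> \<D>" "C \<in> \<D>" "B \<subseteq> C" for B C
    proof -
      have *: "B \<in> sets M" "C - B \<in> sets M" using that by (auto simp: \<D>_def)
      then have "v (B \<union> (C - B)) = v B + v (C - B)" "0 \<le> v (C - B)"
        using v unfolding finite_content_def by blast+
      moreover have "B \<union> (C - B) = C" using that by auto
      ultimately show ?thesis by simp
    qed
  qed
  then obtain B where B: "B \<in> sets M" "qs G \<PP>' (\<lambda>\<omega>. \<omega> \<in> B \<longrightarrow> \<omega> \<in> A)"
      and max: "\<And>C. C \<in> sets M \<Longrightarrow> qs G \<PP>' (\<lambda>\<omega>. \<omega> \<in> C \<longrightarrow> \<omega> \<in> A) \<Longrightarrow> v C \<le> v B"
    unfolding \<D>_def by auto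
  have AB: "A - B \<in> sets G" using A B sets_G by auto
  have "upper_prob \<PP>' (A - B) = 0"
  proof (rule ccontr)
    assume "upper_prob \<PP>' (A - B) \<noteq> 0"
    then obtain C where C: "C \<in> sets M" "upper_prob \<PP>' C \<noteq> 0" "qs G \<PP>' (\<lambda>\<omega>. \<omega> \<in> C \<longrightarrow> \<omega> \<in> A - B)"
      using dense[OF AB] by blast
    \<comment> \<open>\<open>C\<close> avoids \<open>B\<close> only quasi surely;
      \<open>C - B\<close> makes the union truly disjoint, so that additivity applies.\<close>
    have "v (B \<union> (C - B)) \<le> v B"
      using qs_conj'[OF B(2) C(3)] B C by (intro max) (auto elim: qs_mono)
    moreover have "C - B \<in> sets M" using B C by auto
    then have "v (B \<union> (C - B)) = v B + v (C - B)" "0 \<le> v (C - B)"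
      using v B(1) unfolding finite_content_def by blast+
    ultimately have "v (C - B) = 0" by simp
    then have "qs G \<PP>' (\<lambda>\<omega>. \<omega> \<notin> C - B)"
      using C B by (intro pos) (auto elim: qs_mono)
    with C(3) have "qs G \<PP>' (\<lambda>\<omega>. (\<omega> \<in> C \<longrightarrow> \<omega> \<in> A - B) \<and> \<omega> \<notin> C - B)"
      by (rule qs_conj')
    then have "qs G \<PP>' (\<lambda>\<omega>. \<omega> \<notin> C)" by (rule qs_mono) auto
    then show False using C sets_G by (auto simp: qs_notin_iff')
  qed
  then have "qs G \<PP>' (\<lambda>\<omega>. \<omega> \<notin> A - B)" using qs_notin_iff'[OF AB] by simp
  with B(2) have "qs G \<PP>' (\<lambda>\<omega>. (\<omega> \<in> B \<longrightarrow> \<omega> \<in> A) \<and> \<omega> \<notin> A - B)" by (rule qs_conj')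
  then have "qs G \<PP>' (\<lambda>\<omega>. \<omega> \<in> A \<longleftrightarrow> \<omega> \<in> B)" by (rule qs_mono) auto
  with B show ?thesis by blast
qed

lemma ex_qs_eq_support:
  assumes \<mu>: "\<mu> \<in> ca M" and S: "S \<in> sets M"
    and supp: "\<forall>N\<in>sets M. total_variation M \<mu> (N \<inter> S) = 0 \<longrightarrow> upper_prob \<PP> (N \<inter> S) = 0"
    and A: "A \<in> sets G"
  shows "\<exists>B\<in>sets M. qs G \<PP>' (\<lambda>\<omega>. \<omega> \<in> A \<inter> S \<longleftrightarrow> \<omega> \<in> B)"
proof -
  obtain v where v: "finite_content M v" "\<And>A. A \<in> sets M \<Longrightarrow> v A = 0 \<Longrightarrow> total_variation M \<mu> A = 0"
    using ca_finite_content[OF \<mu>] by blast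
  show ?thesis
  proof (rule ex_qs_eq[OF v(1)])
    show "A \<inter> S \<in> sets G" using A S sets_G by auto
    fix C assume C: "C \<in> sets M" "qs G \<PP>' (\<lambda>\<omega>. \<omega> \<in> C \<longrightarrow> \<omega> \<in> A \<inter> S)" "v C = 0"
    \<comment> \<open>\<open>C\<close> lies in \<open>S\<close> only quasi surely, whereas
      \<open>supp\<close> speaks of genuine subsets of \<open>S\<close>; hence the detour through
      \<open>C \<inter> S\<close>.\<close>
    have CS: "C \<inter> S \<in> sets M" using C S by auto
    have "total_variation M \<mu> (C \<inter> S) = 0"
      using total_variation_0_mono(1)[OF \<mu> C(1) CS] v(2)[OF C(1,3)] by auto
    then have "qs G \<PP>' (\<lambda>\<omega>. \<omega> \<notin> C \<inter> S)" using supp C(1) CS null_iff_qs by blast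
    with C(2) have "qs G \<PP>' (\<lambda>\<omega>. (\<omega> \<in> C \<longrightarrow> \<omega> \<in> A \<inter> S) \<and> \<omega> \<notin> C \<inter> S)" by (rule qs_conj')
    then show "qs G \<PP>' (\<lambda>\<omega>. \<omega> \<notin> C)" by (rule qs_mono) auto
  qed
qed

section \<open>Uniqueness of supported extensions\<close>

lemma finite_content_M: "finite_content G v \<Longrightarrow> finite_content M v"
  using sets_G by (auto simp: finite_content_def)

text \<open>A common \<open>B\<close> is the point: two extensions that agree on \<open>M\<close>
  then agree at \<open>A\<close>. Used with the same measure twice, it shows that the values on
  \<open>G\<close> are already taken on \<open>M\<close>.\<close>

lemma sca_c_values:
  assumes \<nu>: "\<nu>\<^sub>1 \<in> sca_c G \<PP>'" "\<nu>\<^sub>2 \<in> sca_c G \<PP>'" and A: "A \<in> sets G"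
  shows "\<exists>B\<in>sets M. \<nu>\<^sub>1 A = \<nu>\<^sub>1 B \<and> \<nu>\<^sub>2 A = \<nu>\<^sub>2 B"
proof -
  have ca: "\<nu>\<^sub>1 \<in> ca G" "\<nu>\<^sub>2 \<in> ca G" and ca_c: "\<nu>\<^sub>1 \<in> ca_c G \<PP>'" "\<nu>\<^sub>2 \<in> ca_c G \<PP>'"
    using \<nu> by (auto simp: sca_c_def ca_c_def)
  obtain S1 where S1: "S1 \<in> sets G" "total_variation G \<nu>\<^sub>1 (space G - S1) = 0"
      "\<And>N. N \<in> sets G \<Longrightarrow> total_variation G \<nu>\<^sub>1 (N \<inter> S1) = 0 \<Longrightarrow> upper_prob \<PP>' (N \<inter> S1) = 0"
    using \<nu>(1) by (auto simp: sca_c_def supported_def)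
  obtain S2 where S2: "S2 \<in> sets G" "total_variation G \<nu>\<^sub>2 (space G - S2) = 0"
      "\<And>N. N \<in> sets G \<Longrightarrow> total_variation G \<nu>\<^sub>2 (N \<inter> S2) = 0 \<Longrightarrow> upper_prob \<PP>' (N \<inter> S2) = 0"
    using \<nu>(2) by (auto simp: sca_c_def supported_def)
  obtain v1 where v1: "finite_content G v1"
      "\<And>A. A \<in> sets G \<Longrightarrow> v1 A = 0 \<Longrightarrow> total_variation G \<nu>\<^sub>1 A = 0"
    using ca_finite_content[OF ca(1)] by blast
  obtain v2 where v2: "finite_content G v2"
      "\<And>A. A \<in> sets G \<Longrightarrow> v2 A = 0 \<Longrightarrow> total_variation G \<nu>\<^sub>2 A = 0"
    using ca_finite_content[OF ca(2)] by blast
  \<comment> \<open>Each measure vanishes off its own support, hence off \<open>S\<close>;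
    conversely, a piece of \<open>S\<close> that is null for both is null on \<open>S1\<close> and
    on \<open>S2\<close>.\<close>
  define S where "S = S1 \<union> S2"
  have S: "S \<in> sets G" using S1 S2 by (auto simp: S_def)
  have "\<exists>B\<in>sets M. qs G \<PP>' (\<lambda>\<omega>. \<omega> \<in> A \<inter> S \<longleftrightarrow> \<omega> \<in> B)"
  proof (rule ex_qs_eq)
    show "finite_content M (\<lambda>A. v1 A + v2 A)"
      using finite_content_M[OF v1(1)] finite_content_M[OF v2(1)] by (auto simp: finite_content_def)
    show "A \<inter> S \<in> sets G" using A S by auto
    fix C assume C: "C \<in> sets M" "qs G \<PP>' (\<lambda>\<omega>. \<omega> \<in> C \<longrightarrow> \<omega> \<in> A \<inter> S)" "v1 C + v2 C = 0"
    then have CG: "C \<in> sets G" using sets_G by blast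
    have "0 \<le> v1 C" "0 \<le> v2 C" using v1(1) v2(1) CG by (auto simp: finite_content_def)
    with C(3) have "v1 C = 0" "v2 C = 0" by auto
    then have "total_variation G \<nu>\<^sub>1 C = 0" "total_variation G \<nu>\<^sub>2 C = 0"
      using v1 v2 CG by auto
    moreover have CS: "C \<inter> S1 \<in> sets G" "C \<inter> S2 \<in> sets G" using CG S1 S2 by auto
    ultimately have "total_variation G \<nu>\<^sub>1 (C \<inter> S1) = 0" "total_variation G \<nu>\<^sub>2 (C \<inter> S2) = 0"
      using total_variation_0_mono(1)[OF ca(1) CG] total_variation_0_mono(1)[OF ca(2) CG] by auto
    then have "qs G \<PP>' (\<lambda>\<omega>. \<omega> \<notin> C \<inter> S1)" "qs G \<PP>' (\<lambda>\<omega>. \<omega> \<notin> C \<inter> S2)"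
      using S1(3)[OF CG] S2(3)[OF CG] CS by (auto simp only: qs_notin_iff')
    from qs_conj'[OF C(2) qs_conj'[OF this]] show "qs G \<PP>' (\<lambda>\<omega>. \<omega> \<notin> C)"
      by (rule qs_mono) (auto simp: S_def)
  qed
  then obtain B where B: "B \<in> sets M" "qs G \<PP>' (\<lambda>\<omega>. \<omega> \<in> A \<inter> S \<longleftrightarrow> \<omega> \<in> B)" by blast
  have "\<nu>\<^sub>1 A = \<nu>\<^sub>1 (A \<inter> S)"
    using ca_split[OF ca(1) A S] total_variation_0_mono(2)[OF ca(1) _ _ _ S1(2), of "A - S"]
      sets.sets_into_space[OF A] A S S1(1) by (auto simp: S_def)
  moreover have "\<nu>\<^sub>2 A = \<nu>\<^sub>2 (A \<inter> S)"
    using ca_split[OF ca(2) A S] total_variation_0_mono(2)[OF ca(2) _ _ _ S2(2), of "A - S"]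
      sets.sets_into_space[OF A] A S S2(1) by (auto simp: S_def)
  moreover have "\<nu>\<^sub>1 (A \<inter> S) = \<nu>\<^sub>1 B" "\<nu>\<^sub>2 (A \<inter> S) = \<nu>\<^sub>2 B"
    using ca_c_cong_qs[OF prob' ca_c(1) _ _ B(2)] ca_c_cong_qs[OF prob' ca_c(2) _ _ B(2)]
      A S B(1) sets_G by auto
  ultimately show ?thesis using B(1) by auto
qed

lemma sca_extension_unique:
  assumes "sca_extension M G \<PP>' \<mu> \<nu>\<^sub>1" "sca_extension M G \<PP>' \<mu> \<nu>\<^sub>2"
  shows "\<nu>\<^sub>1 = \<nu>\<^sub>2"
proof
  fix A
  have \<nu>: "\<nu>\<^sub>1 \<in> sca_c G \<PP>'" "\<nu>\<^sub>2 \<in> sca_c G \<PP>'" "\<forall>B\<in>sets M. \<nu>\<^sub>1 B = \<mu> B" "\<forall>B\<in>sets M. \<nu>\<^sub>2 B = \<mu> B"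
    using assms by (auto simp: sca_extension_def)
  show "\<nu>\<^sub>1 A = \<nu>\<^sub>2 A"
  proof (cases "A \<in> sets G")
    case True
    then show ?thesis using sca_c_values[OF \<nu>(1,2)] \<nu>(3,4) by metis
  next
    case False
    then show ?thesis using \<nu>(1,2) by (auto simp: sca_c_def ca_c_def ca_def)
  qed
qed

section \<open>Existence of supported extensions\<close>

lemma sca_extension_exists:
  assumes \<mu>: "\<mu> \<in> sca_c M \<PP>"
  shows "\<exists>\<nu>. sca_extension M G \<PP>' \<mu> \<nu>"
proof -
  have ca: "\<mu> \<in> ca M" and ca_c: "\<mu> \<in> ca_c M \<PP>" using \<mu> by (auto simp: sca_c_def ca_c_def)
  obtain S where S: "S \<in> sets M" "total_variation M \<mu> (space M - S) = 0"
      "\<forall>N\<in>sets M. total_variation M \<mu> (N \<inter> S) = 0 \<longrightarrow> upper_prob \<PP> (N \<inter> S) = 0"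
    using \<mu> by (auto simp: sca_c_def supported_def)
  have SG: "S \<in> sets G" using S sets_G by auto
  obtain r where r: "\<And>A. A \<in> sets G \<Longrightarrow> r A \<in> sets M"
      "\<And>A. A \<in> sets G \<Longrightarrow> qs G \<PP>' (\<lambda>\<omega>. \<omega> \<in> A \<inter> S \<longleftrightarrow> \<omega> \<in> r A)"
    using ex_qs_eq_support[OF ca S(1,3)] by metis
  define \<nu> where "\<nu> A = (if A \<in> sets G then \<mu> (r A) else 0)" for A
  \<comment> \<open>Any event of \<open>M\<close> quasi-surely equal to \<open>A \<inter> S\<close>
    computes the value, so the arbitrary choice of \<open>r\<close> disappears from the remaining
    argument.\<close>
  have \<nu>_eq: "\<nu> A = \<mu> B" if "A \<in> sets G" "B \<in> sets M" "qs G \<PP>' (\<lambda>\<omega>. \<omega> \<in> A \<inter> S \<longleftrightarrow> \<omega> \<in> B)" for A B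
  proof -
    have "qs G \<PP>' (\<lambda>\<omega>. \<omega> \<in> r A \<longleftrightarrow> \<omega> \<in> B)"
      using qs_conj'[OF that(3) r(2)[OF that(1)]] by (rule qs_mono) auto
    then have "\<mu> (r A) = \<mu> B"
      using that r by (intro ca_c_cong_qs[OF prob ca_c] qs_M_eq)
    then show ?thesis using that by (simp add: \<nu>_def)
  qed
  have qs_True: "qs G \<PP>' (\<lambda>\<omega>. True)"
    by (auto simp: qs_def upper_prob_eq_0_iff intro!: bexI[of _ "{}"])
  have \<nu>_0: "\<nu> A = 0" if "A \<in> sets G" "qs G \<PP>' (\<lambda>\<omega>. \<omega> \<notin> A \<inter> S)" for A
  proof -
    have "\<nu> A = \<mu> {}" using that(2) by (intro \<nu>_eq[OF that(1)]) (auto elim: qs_mono)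
    then show ?thesis using ca_empty[OF ca] by simp
  qed
  have \<nu>_ca: "\<nu> \<in> ca G"
    unfolding ca_def
  proof (intro CollectI conjI allI impI)
    show "\<nu> A = 0" if "A \<notin> sets G" for A using that by (simp add: \<nu>_def)
    fix A :: "nat \<Rightarrow> 'a set" assume A: "range A \<subseteq> sets G" "disjoint_family A"
    \<comment> \<open>The chosen \<open>r (A n)\<close> are disjoint only quasi surely. Making them
      disjoint changes each by a null set and leaves the union as it is.\<close>
    define B where "B = disjointed (\<lambda>n. r (A n))"
    have rA: "range (\<lambda>n. r (A n)) \<subseteq> sets M" using A(1) r(1) by auto
    have BM: "range B \<subseteq> sets M" unfolding B_def using rA by (rule sets.range_disjointed_sets)
    have q: "qs G \<PP>' (\<lambda>\<omega>. \<forall>n. \<omega> \<in> A n \<inter> S \<longleftrightarrow> \<omega> \<in> r (A n))"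
      using A(1) r(2) by (intro qs_all[OF prob']) auto
    have "\<nu> (A n) = \<mu> (B n)" for n
    proof (rule \<nu>_eq)
      show "A n \<in> sets G" "B n \<in> sets M" using A BM by auto
      have "\<omega> \<in> A n \<inter> S \<longleftrightarrow> \<omega> \<in> B n" if "\<forall>n. \<omega> \<in> A n \<inter> S \<longleftrightarrow> \<omega> \<in> r (A n)" for \<omega>
        using that disjoint_family_onD[OF A(2), of _ n] unfolding B_def disjointed_def by force
      then show "qs G \<PP>' (\<lambda>\<omega>. \<omega> \<in> A n \<inter> S \<longleftrightarrow> \<omega> \<in> B n)" by (rule qs_mono[OF q])
    qed
    moreover have "\<nu> (\<Union>n. A n) = \<mu> (\<Union>n. B n)"
    proof (rule \<nu>_eq)
      show "(\<Union>n. A n) \<in> sets G" "(\<Union>n. B n) \<in> sets M" using A BM by auto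
      have "(\<Union>n. B n) = (\<Union>n. r (A n))" unfolding B_def by (rule UN_disjointed_eq)
      then show "qs G \<PP>' (\<lambda>\<omega>. \<omega> \<in> (\<Union>n. A n) \<inter> S \<longleftrightarrow> \<omega> \<in> (\<Union>n. B n))"
        by (intro qs_mono[OF q]) auto
    qed
    moreover have "(\<lambda>n. \<mu> (B n)) sums \<mu> (\<Union>n. B n)"
      using BM disjoint_family_disjointed unfolding B_def by (intro ca_sums[OF ca])
    ultimately show "(\<lambda>n. \<nu> (A n)) sums \<nu> (\<Union>n. A n)" by simp
  qed
  have \<nu>_ca_c: "\<nu> \<in> ca_c G \<PP>'"
  proof -
    have "total_variation G \<nu> N = 0" if N: "N \<in> sets G" "upper_prob \<PP>' N = 0" for N
      unfolding total_variation_eq_0_iff[OF \<nu>_ca N(1)]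
    proof (intro ballI impI)
      fix B assume B: "B \<in> sets G" "B \<subseteq> N"
      have "qs G \<PP>' (\<lambda>\<omega>. \<omega> \<notin> N)" using N by (simp add: qs_notin_iff')
      then show "\<nu> B = 0" using B by (intro \<nu>_0) (auto elim: qs_mono)
    qed
    then show ?thesis
      using \<nu>_ca by (auto simp: ca_c_def dominated_by_def SUP_total_variation[OF prob'])
  qed
  have "supported G \<PP>' (total_variation G \<nu>)"
    unfolding supported_def
  proof (intro bexI[of _ S] conjI ballI impI SG)
    have "space G - S \<in> sets G" using SG by auto
    then show "total_variation G \<nu> (space G - S) = 0"
      unfolding total_variation_eq_0_iff[OF \<nu>_ca \<open>space G - S \<in> sets G\<close>]
      by (intro ballI impI \<nu>_0 qs_mono[OF qs_True]) auto
    fix N assume N: "N \<in> sets G" "total_variation G \<nu> (N \<inter> S) = 0"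
    have NS: "N \<inter> S \<in> sets G" using N SG by auto
    \<comment> \<open>The set \<open>S\<close> supports the extension too. Cutting
      \<open>r N\<close> by \<open>S\<close> changes it by a null set only and gives it the form to
      which the support property of \<open>\<mu>\<close> applies.\<close>
    define B where "B = r N \<inter> S"
    have B: "B \<in> sets M" using r(1)[OF N(1)] S by (auto simp: B_def)
    have qB: "qs G \<PP>' (\<lambda>\<omega>. \<omega> \<in> N \<inter> S \<longleftrightarrow> \<omega> \<in> B)"
      using r(2)[OF N(1)] by (rule qs_mono) (auto simp: B_def)
    have "total_variation M \<mu> B = 0"
      unfolding total_variation_eq_0_iff[OF ca B]
    proof (intro ballI impI)
      fix C assume C: "C \<in> sets M" "C \<subseteq> B"
      \<comment> \<open>\<open>C\<close> need not lie in \<open>N \<inter> S\<close>, but since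
        \<open>B\<close> is quasi-surely equal to that set, the intersection differs from
        \<open>C\<close> by a null set.\<close>
      have CN: "C \<inter> (N \<inter> S) \<in> sets G" using C sets_G NS by auto
      have "\<nu> (C \<inter> (N \<inter> S)) = \<mu> C"
        using CN C(1) by (rule \<nu>_eq, intro qs_mono[OF qB]) (use C in auto)
      moreover have "\<nu> (C \<inter> (N \<inter> S)) = 0"
        using total_variation_0_mono(2)[OF \<nu>_ca NS CN _ N(2)] by auto
      ultimately show "\<mu> C = 0" by simp
    qed
    then have "upper_prob \<PP> B = 0"
      using S(3)[rule_format, OF B] by (simp add: B_def Int_assoc)
    then have "qs G \<PP>' (\<lambda>\<omega>. \<omega> \<notin> B)" using B null_iff_qs by simp
    from qs_conj'[OF this qB] have "qs G \<PP>' (\<lambda>\<omega>. \<omega> \<notin> N \<inter> S)" by (rule qs_mono) auto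
    then show "upper_prob \<PP>' (N \<inter> S) = 0" using qs_notin_iff'[OF NS] by simp
  qed
  moreover have "\<nu> A = \<mu> A" if A: "A \<in> sets M" for A
  proof -
    have "\<nu> A = \<mu> (A \<inter> S)"
      using A S by (intro \<nu>_eq qs_mono[OF qs_True]) (auto simp: sets_G)
    moreover have "\<mu> (A - S) = 0"
      using A S sets.sets_into_space[OF A] by (intro total_variation_0_mono(2)[OF ca _ _ _ S(2)]) auto
    ultimately show ?thesis using ca_split[OF ca A S(1)] by simp
  qed
  ultimately have "sca_extension M G \<PP>' \<mu> \<nu>"
    using \<nu>_ca_c by (auto simp: sca_extension_def sca_c_def)
  then show ?thesis by blast
qed

lemma sca_extension_ex1: "\<mu> \<in> sca_c M \<PP> \<Longrightarrow> \<exists>!\<nu>. sca_extension M G \<PP>' \<mu> \<nu>"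
  using sca_extension_exists sca_extension_unique by blast

lemma sca_extension_sca_ext: "\<mu> \<in> sca_c M \<PP> \<Longrightarrow> sca_extension M G \<PP>' \<mu> (sca_ext M G \<PP>' \<mu>)"
  unfolding sca_ext_def by (rule theI'[OF sca_extension_ex1])

section \<open>Extending probability measures and supported alternatives\<close>

lemma prob_ext:
  assumes Q: "Q \<in> prob_measures M" "measure Q \<in> sca_c M \<PP>"
  shows "prob_ext M G \<PP>' Q \<in> prob_measures G"
    and "measure (prob_ext M G \<PP>' Q) = sca_ext M G \<PP>' (measure Q)"
proof -
  define \<nu> where "\<nu> = sca_ext M G \<PP>' (measure Q)"
  have \<nu>: "\<nu> \<in> sca_c G \<PP>'" "\<And>A. A \<in> sets M \<Longrightarrow> \<nu> A = measure Q A"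
    using sca_extension_sca_ext[OF Q(2)] by (auto simp: \<nu>_def sca_extension_def)
  have ca: "\<nu> \<in> ca G" using \<nu> by (auto simp: sca_c_def ca_c_def)
  \<comment> \<open>Positivity is inherited: every value of \<open>\<nu>\<close> is one of its
    values on \<open>M\<close>, hence a value of \<open>measure Q\<close>.\<close>
  have pos: "0 \<le> \<nu> A" if "A \<in> sets G" for A
    using sca_c_values[OF \<nu>(1,1) that] \<nu>(2) by force
  have "countably_additive (sets G) (\<lambda>A. ennreal (\<nu> A))"
  proof (rule countably_additiveI)
    fix A :: "nat \<Rightarrow> 'a set" assume A: "range A \<subseteq> sets G" "disjoint_family A" "\<Union> (range A) \<in> sets G"
    show "(\<Sum>i. ennreal (\<nu> (A i))) = ennreal (\<nu> (\<Union> (range A)))"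
      using A(1) ca_sums[OF ca A(1,2)] by (intro suminf_ennreal_eq pos) auto
  qed
  moreover have "positive (sets G) (\<lambda>A. ennreal (\<nu> A))"
    using ca_empty[OF ca] by (simp add: positive_def)
  ultimately have em: "emeasure (prob_ext M G \<PP>' Q) A = ennreal (\<nu> A)" if "A \<in> sets G" for A
    using that sets.sigma_algebra_axioms unfolding prob_ext_def \<nu>_def[symmetric]
    by (intro emeasure_measure_of_sigma)
  have sets: "sets (prob_ext M G \<PP>' Q) = sets G"
    unfolding prob_ext_def by (simp add: sets.space_closed)
  have space: "space (prob_ext M G \<PP>' Q) = space G" using sets by (rule sets_eq_imp_space_eq)
  have "measure (prob_ext M G \<PP>' Q) A = \<nu> A" for A
  proof (cases "A \<in> sets G")
    case True
    then show ?thesis using em pos by (simp add: measure_def)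
  next
    case False
    then show ?thesis using ca sets by (auto simp: measure_notin_sets ca_def)
  qed
  then show "measure (prob_ext M G \<PP>' Q) = sca_ext M G \<PP>' (measure Q)" by (auto simp: \<nu>_def)
  have "space G \<in> sets M" using space_eq by simp
  moreover have "measure Q (space G) = 1"
  proof -
    have "space Q = space M" "prob_space Q" using Q(1) by (auto simp: prob_measures_def dest: sets_eq_imp_space_eq)
    then show ?thesis using prob_space.prob_space[of Q] by (simp add: space_eq)
  qed
  ultimately have "emeasure (prob_ext M G \<PP>' Q) (space G) = 1"
    using \<nu>(2) by (subst em) auto
  then show "prob_ext M G \<PP>' Q \<in> prob_measures G"
    using sets space by (auto simp: prob_measures_def intro: prob_spaceI)
qed

text \<open>Membership in \<open>sca_c\<close> already contains domination by \<open>\<PP>'\<close>.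
  Conversely, an event charged by \<open>\<PP>'\<close> contains, quasi surely, an event of
  \<open>M\<close> charged by \<open>\<PP>'\<close> and so by some \<open>Q\<close> in
  \<open>\<QQ>\<close>; the extension of this \<open>Q\<close> charges the larger event.\<close>

lemma supported_alternative_prob_ext:
  assumes \<QQ>: "supported_alternative M \<PP> \<QQ>"
  shows "supported_alternative G \<PP>' (prob_ext M G \<PP>' ` \<QQ>)"
proof -
  define \<QQ>' where "\<QQ>' = prob_ext M G \<PP>' ` \<QQ>"
  have Q: "\<QQ> \<subseteq> prob_measures M" "equiv_sets M (measure ` \<QQ>) (measure ` \<PP>)"
      "\<And>Q. Q \<in> \<QQ> \<Longrightarrow> measure Q \<in> sca_c M \<PP>"
    using \<QQ> by (auto simp: supported_alternative_def)
  have \<QQ>': "\<QQ>' \<subseteq> prob_measures G" using prob_ext(1) Q(1,3) by (auto simp: \<QQ>'_def)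
  have ext: "sca_extension M G \<PP>' (measure Q) (measure (prob_ext M G \<PP>' Q))" if "Q \<in> \<QQ>" for Q
    using that Q sca_extension_sca_ext[of "measure Q"] prob_ext(2)[of Q] by auto
  have sca: "measure ` \<QQ>' \<subseteq> sca_c G \<PP>'"
    using ext by (auto simp: \<QQ>'_def sca_extension_def)
  have "upper_prob \<QQ>' N = 0" if N: "N \<in> sets G" "upper_prob \<PP>' N = 0" for N
  proof -
    have "emeasure R N = 0" if R: "R \<in> \<QQ>'" for R
    proof -
      have "measure R \<in> ca_c G \<PP>'" "R \<in> prob_measures G" using R sca \<QQ>' by (auto simp: sca_c_def)
      then show ?thesis using ca_c_null[OF prob' _ N] N total_variation_measure by metis
    qed
    then show ?thesis by (simp add: upper_prob_eq_0_iff)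
  qed
  moreover have "upper_prob \<PP>' N = 0" if N: "N \<in> sets G" "upper_prob \<QQ>' N = 0" for N
  proof (rule ccontr)
    assume "upper_prob \<PP>' N \<noteq> 0"
    then obtain B where B: "B \<in> sets M" "upper_prob \<PP>' B \<noteq> 0" "qs G \<PP>' (\<lambda>\<omega>. \<omega> \<in> B \<longrightarrow> \<omega> \<in> N)"
      using dense N by blast
    have BG: "B \<in> sets G" using B sets_G by auto
    have "upper_prob \<QQ> B \<noteq> 0"
      using B null_iff equiv_sets_measure_iff[OF Q(1) prob] Q(2) by simp
    then obtain Q where QQ: "Q \<in> \<QQ>" "emeasure Q B \<noteq> 0" by (auto simp: upper_prob_eq_0_iff)
    define R where "R = prob_ext M G \<PP>' Q"
    have RQ: "R \<in> \<QQ>'" using QQ by (simp add: R_def \<QQ>'_def)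
    then have R: "prob_space R" "sets R = sets G" "measure R \<in> ca_c G \<PP>'"
      using \<QQ>' sca by (auto simp: prob_measures_def sca_c_def)
    interpret R: prob_space R by fact
    interpret Q: prob_space Q using QQ Q(1) by (auto simp: prob_measures_def)
    have "measure R B = measure Q B" using ext[OF QQ(1)] B by (auto simp: sca_extension_def R_def)
    moreover have "measure R B = measure R (B \<inter> N)"
      using ca_c_cong_qs[OF prob' R(3) BG _ qs_mono[OF B(3)], of "B \<inter> N"] BG N by auto
    moreover have "measure R (B \<inter> N) \<le> measure R N"
      using R(2) N by (intro R.finite_measure_mono) auto
    moreover have "measure R N = 0"
      using N RQ by (simp add: upper_prob_eq_0_iff measure_def)
    ultimately have "measure Q B = 0" by (simp add: measure_le_0_iff)
    then show False using QQ by (simp add: Q.emeasure_eq_measure)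
  qed
  ultimately have "equiv_sets G (measure ` \<QQ>') (measure ` \<PP>')"
    unfolding equiv_sets_measure_iff[OF \<QQ>' prob'] by blast
  then show ?thesis using \<QQ>' sca unfolding \<QQ>'_def supported_alternative_def by blast
qed

end

section \<open>From order density of classes to density of events\<close>

lemma completes_Linf_dense_enlargement:
  assumes \<PP>: "\<PP> \<subseteq> prob_measures M" and compl: "completes_Linf M \<PP> G \<PP>'"
  shows "dense_enlargement M G \<PP> \<PP>'"
proof
  have enl: "enlargement M \<PP> G \<PP>'" and od: "order_dense (Linf G \<PP>') (J_map G \<PP>' ` elems (Linf M \<PP>))"
    using compl by (auto simp: completes_Linf_def dedekind_completion_def)
  show sub: "subalgebra G M" and \<PP>': "\<PP>' \<subseteq> prob_measures G"
    using enl by (auto simp: enlargement_def)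
  show "\<PP> \<subseteq> prob_measures M" by fact
  have restr: "restr_to_subalg P M \<in> prob_measures M \<and> (\<forall>N\<in>sets M. emeasure (restr_to_subalg P M) N = emeasure P N)"
    if "P \<in> \<PP>'" for P
  proof -
    have "sets P = sets G" "prob_space P" using that \<PP>' by (auto simp: prob_measures_def)
    then have "subalgebra P M" using sub sets_eq_imp_space_eq[of P G] by (simp add: subalgebra_def)
    then show ?thesis
      using prob_space_restr_to_subalg \<open>prob_space P\<close>
      by (auto simp: prob_measures_def sets_restr_to_subalg emeasure_restr_to_subalg)
  qed
  show "upper_prob \<PP>' N = 0 \<longleftrightarrow> upper_prob \<PP> N = 0" if N: "N \<in> sets M" for N
  proof -
    have "(\<lambda>P. restr_to_subalg P M) ` \<PP>' \<subseteq> prob_measures M" using restr by auto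
    then have "upper_prob ((\<lambda>P. restr_to_subalg P M) ` \<PP>') N = 0 \<longleftrightarrow> upper_prob \<PP> N = 0"
      using equiv_sets_measure_iff[OF _ \<PP>] enl N by (auto simp: enlargement_def)
    then show ?thesis using restr N by (auto simp: upper_prob_eq_0_iff)
  qed
  fix A assume A: "A \<in> sets G" "upper_prob \<PP>' A \<noteq> 0"
  define u where "u = (indicator A :: 'a \<Rightarrow> real)"
  have u: "u \<in> borel_measurable G" using A by (simp add: u_def)
  have "qs_class G \<PP>' u \<in> elems (Linf G \<PP>')"
    using \<PP>' u by (rule qs_class_in_Linf[where m = 1]) (simp add: u_def indicator_def)
  moreover have "vless (Linf G \<PP>') (vzero (Linf G \<PP>')) (qs_class G \<PP>' u)"
  proof -
    have "\<not> qs G \<PP>' (\<lambda>\<omega>. 0 = u \<omega>)"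
    proof
      assume "qs G \<PP>' (\<lambda>\<omega>. 0 = u \<omega>)"
      then have "qs G \<PP>' (\<lambda>\<omega>. \<omega> \<notin> A)" by (rule qs_mono) (auto simp: u_def)
      then show False using A \<PP>' by (simp add: qs_notin_iff)
    qed
    moreover have "qs G \<PP>' (\<lambda>\<omega>. 0 \<le> u \<omega>)"
      by (auto simp: qs_def upper_prob_eq_0_iff u_def intro!: bexI[of _ "{}"])
    ultimately show ?thesis
      using \<PP>' u by (simp add: vless_def vzero_Linf vle_Linf_qs_class qs_class_eq_iff)
  qed
  ultimately obtain X where X: "X \<in> elems (Linf M \<PP>)" "vless (Linf G \<PP>') (vzero (Linf G \<PP>')) (J_map G \<PP>' X)"
      "vle (Linf G \<PP>') (J_map G \<PP>' X) (qs_class G \<PP>' u)"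
    using od unfolding order_dense_def by blast
  obtain f where f: "f \<in> borel_measurable M" "X = qs_class M \<PP> f"
    using Linf_elemE[OF \<PP> X(1)] by metis
  have fG: "f \<in> borel_measurable G" using f sub by (auto intro: measurable_from_subalg)
  have J: "J_map G \<PP>' X = qs_class G \<PP>' f" using J_map_qs_class[OF enl \<PP> f(1)] f(2) by simp
  have f0: "qs G \<PP>' (\<lambda>\<omega>. 0 \<le> f \<omega>)" "\<not> qs G \<PP>' (\<lambda>\<omega>. 0 = f \<omega>)" and f1: "qs G \<PP>' (\<lambda>\<omega>. f \<omega> \<le> u \<omega>)"
    using X(2,3) fG u \<PP>' by (simp_all add: J vless_def vzero_Linf vle_Linf_qs_class qs_class_eq_iff)
  \<comment> \<open>With \<open>f\<close> between 0 and the indicator of \<open>A\<close>,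
    positivity of \<open>f\<close> forces membership in \<open>A\<close>, and \<open>B\<close> is
    not null because the class of \<open>f\<close> is not 0.\<close>
  define B where "B = {\<omega> \<in> space M. 0 < f \<omega>}"
  have B: "B \<in> sets M" using f(1) by (simp add: B_def)
  then have BG: "B \<in> sets G" using sub by (auto simp: subalgebra_def)
  have sp: "space G = space M" using sub by (simp add: subalgebra_def)
  have "upper_prob \<PP>' B \<noteq> 0"
  proof
    assume "upper_prob \<PP>' B = 0"
    then have "qs G \<PP>' (\<lambda>\<omega>. \<omega> \<notin> B)" using BG \<PP>' by (simp add: qs_notin_iff)
    from qs_conj[OF \<PP>' this f0(1)] have "qs G \<PP>' (\<lambda>\<omega>. 0 = f \<omega>)"
      by (rule qs_mono) (auto simp: B_def sp)
    then show False using f0 by blast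
  qed
  moreover have "qs G \<PP>' (\<lambda>\<omega>. \<omega> \<in> B \<longrightarrow> \<omega> \<in> A)"
    using f1 by (rule qs_mono) (auto simp: B_def u_def indicator_def of_bool_def split: if_splits)
  ultimately show "\<exists>B\<in>sets M. upper_prob \<PP>' B \<noteq> 0 \<and> qs G \<PP>' (\<lambda>\<omega>. \<omega> \<in> B \<longrightarrow> \<omega> \<in> A)"
    using B by blast
qed

section \<open>The joint completion\<close>

text \<open>The null set is fixed before the filling \<open>k\<close>: the same one has to work for
  a constant and, later, for a function that is constructed from this null set itself.\<close>

lemma completion_modification:
  fixes f :: "'a \<Rightarrow> real"
  assumes "f \<in> borel_measurable (completion Q)"
  shows "\<exists>N\<in>null_sets Q. \<forall>k\<in>borel_measurable Q. (\<lambda>\<omega>. if \<omega> \<in> N then k \<omega> else f \<omega>) \<in> borel_measurable Q"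
proof -
  obtain g where g: "g \<in> borel_measurable Q" "AE \<omega> in Q. f \<omega> = g \<omega>"
    using completion_ex_borel_measurable_real[OF assms] by blast
  obtain N where N: "N \<in> null_sets Q" "{\<omega> \<in> space Q. f \<omega> \<noteq> g \<omega>} \<subseteq> N"
    using g(2) unfolding eventually_ae_filter by auto
  show ?thesis
  proof (intro bexI[OF _ N(1)] ballI)
    fix k :: "'a \<Rightarrow> real" assume k: "k \<in> borel_measurable Q"
    have "(\<lambda>\<omega>. if \<omega> \<in> N then k \<omega> else g \<omega>) \<in> borel_measurable Q"
      using g(1) k N(1) by (intro measurable_If_set) (auto simp: null_sets_def)
    then show "(\<lambda>\<omega>. if \<omega> \<in> N then k \<omega> else f \<omega>) \<in> borel_measurable Q"
      using N(2) by (subst measurable_cong[where g = "\<lambda>\<omega>. if \<omega> \<in> N then k \<omega> else g \<omega>"]) auto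
  qed
qed

text \<open>Here \<open>\<SS>\<close> is the extended alternative, retained as a set of probability
  measures with the null events of \<open>\<PP>'\<close>.\<close>

locale joint_completion_enlargement =
  fixes G :: "'a measure" and \<PP>' \<SS> :: "'a measure set"
  assumes prob': "\<PP>' \<subseteq> prob_measures G" and prob_S: "\<SS> \<subseteq> prob_measures G"
    and null_iff: "N \<in> sets G \<Longrightarrow> upper_prob \<SS> N = 0 \<longleftrightarrow> upper_prob \<PP>' N = 0"
begin

abbreviation "H \<equiv> joint_completion G \<SS>"
abbreviation "\<RR> \<equiv> joint_completion_probs G \<SS>"

lemma space_H: "space H = space G"
  unfolding joint_completion_def by simp

lemma sets_H: "sets H = sigma_sets (space G)
    (Pow (space G) \<inter> (\<Inter>\<mu>\<in>\<SS>. sigma_sets (space G) (sets G \<union> null_subsets G \<mu>)))"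
  unfolding joint_completion_def by (rule sets_measure_of) auto

lemma subalgebra_H: "subalgebra H G"
proof -
  have "A \<in> sets H" if "A \<in> sets G" for A
    unfolding sets_H using that sets.sets_into_space[OF that] by (auto intro!: sigma_sets.Basic)
  then show ?thesis by (auto simp: subalgebra_def space_H)
qed

lemma SS_memberD:
  assumes "Q \<in> \<SS>" shows "prob_space Q" "sets Q = sets G" "space Q = space G"
  using assms prob_S by (auto simp: prob_measures_def dest: sets_eq_imp_space_eq)

text \<open>This reduces questions about \<open>H\<close> to the completion of one \<open>Q\<close>
  at a time.\<close>

lemma subalgebra_completion: assumes Q: "Q \<in> \<SS>" shows "subalgebra (completion Q) H"
proof -
  have "null_subsets G Q \<subseteq> sets (completion Q)"
    using SS_memberD[OF Q] by (auto simp: null_subsets_def intro!: sets_completionI_sub null_setsI)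
  moreover have "sets G \<subseteq> sets (completion Q)"
    using SS_memberD[OF Q] by auto
  ultimately have "sigma_sets (space (completion Q)) (sets G \<union> null_subsets G Q) \<subseteq> sets (completion Q)"
    by (intro sets.sigma_sets_subset) auto
  then have "sigma_sets (space (completion Q)) (Pow (space G) \<inter>
      (\<Inter>\<mu>\<in>\<SS>. sigma_sets (space G) (sets G \<union> null_subsets G \<mu>))) \<subseteq> sets (completion Q)"
    using Q SS_memberD[OF Q] by (intro sets.sigma_sets_subset) auto
  then show ?thesis
    using SS_memberD[OF Q] by (simp add: subalgebra_def sets_H space_H)
qed

lemma subalgebra_prob: "R \<in> prob_measures H \<Longrightarrow> subalgebra R G"
  using subalgebra_H by (auto simp: prob_measures_def subalgebra_def dest: sets_eq_imp_space_eq)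

text \<open>An event of the completion is squeezed between \<open>B\<close> and
  \<open>B \<union> N'\<close>, both in \<open>G\<close> and of equal \<open>Q\<close>-measure, so
  the extension has no freedom.\<close>

lemma extension_value:
  assumes Q: "Q \<in> \<SS>" and R: "R \<in> prob_measures H" "restr_to_subalg R G = Q" and A: "A \<in> sets H"
  shows "emeasure R A = emeasure (completion Q) A"
proof -
  have RG: "emeasure R B = emeasure Q B" if "B \<in> sets G" for B
    using emeasure_restr_to_subalg[OF subalgebra_prob[OF R(1)] that] R(2) by simp
  have sR: "sets R = sets H" using R by (auto simp: prob_measures_def)
  obtain B N N' where B: "A = B \<union> N" "N \<subseteq> N'" "N' \<in> null_sets Q" "B \<in> sets Q"
  proof (rule sets_completionE)
    show "A \<in> sets (completion Q)" using A subalgebra_completion[OF Q] by (auto simp: subalgebra_def)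
  qed
  have BG: "B \<in> sets G" "N' \<in> sets G" "B \<union> N' \<in> sets G" using B SS_memberD[OF Q] by auto
  then have BH: "B \<in> sets H" "N' \<in> sets H" using subalgebra_H by (auto simp: subalgebra_def)
  have "emeasure R A \<le> emeasure R (B \<union> N')" using B BH sR by (intro emeasure_mono) auto
  also have "\<dots> = emeasure Q B" using RG[OF BG(3)] B by (simp add: emeasure_Un_null_set)
  finally have "emeasure R A \<le> emeasure Q B" .
  moreover have "emeasure Q B \<le> emeasure R A"
    using RG[OF BG(1)] B A sR emeasure_mono[of B A R] by auto
  moreover have "emeasure (completion Q) A = emeasure Q B"
  proof (rule antisym)
    have "A \<in> sets (completion Q)" using A subalgebra_completion[OF Q] by (auto simp: subalgebra_def)
    then show "emeasure Q B \<le> emeasure (completion Q) A"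
      using B emeasure_mono[of B A "completion Q"] by auto
    have "emeasure (completion Q) A \<le> emeasure (completion Q) (B \<union> N')"
      using B by (intro emeasure_mono) auto
    also have "\<dots> = emeasure Q B" using BG SS_memberD[OF Q] B by (simp add: emeasure_Un_null_set)
    finally show "emeasure (completion Q) A \<le> emeasure Q B" .
  qed
  ultimately show ?thesis by simp
qed

lemma ex1_extension:
  assumes Q: "Q \<in> \<SS>"
  shows "\<exists>!R. R \<in> prob_measures H \<and> restr_to_subalg R G = Q"
proof (rule ex1I)
  note sub = subalgebra_completion[OF Q]
  let ?R = "restr_to_subalg (completion Q) H"
  have R: "?R \<in> prob_measures H"
    using prob_space_restr_to_subalg[OF sub] prob_space.prob_space_completion[OF SS_memberD(1)[OF Q]]
    by (simp add: prob_measures_def sets_restr_to_subalg[OF sub])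
  moreover have "restr_to_subalg ?R G = Q"
  proof (rule measure_eqI)
    show "sets (restr_to_subalg ?R G) = sets Q"
      using sets_restr_to_subalg[OF subalgebra_prob[OF R]] SS_memberD[OF Q] by simp
    fix A assume "A \<in> sets (restr_to_subalg ?R G)"
    then have A: "A \<in> sets G" using sets_restr_to_subalg[OF subalgebra_prob[OF R]] by simp
    then have "A \<in> sets H" using subalgebra_H by (auto simp: subalgebra_def)
    then show "emeasure (restr_to_subalg ?R G) A = emeasure Q A"
      using A SS_memberD[OF Q] emeasure_restr_to_subalg[OF subalgebra_prob[OF R] A] emeasure_restr_to_subalg[OF sub]
      by simp
  qed
  ultimately show "?R \<in> prob_measures H \<and> restr_to_subalg ?R G = Q" by blast
  fix R' assume R': "R' \<in> prob_measures H \<and> restr_to_subalg R' G = Q"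
  show "R' = ?R"
  proof (rule measure_eqI)
    show "sets R' = sets ?R" using R R' by (simp add: prob_measures_def)
    fix A assume "A \<in> sets R'"
    then have "A \<in> sets H" using R' by (simp add: prob_measures_def)
    then show "emeasure R' A = emeasure ?R A"
      using extension_value[OF Q] R' emeasure_restr_to_subalg[OF sub] by simp
  qed
qed

section \<open>The enlargement by the joint completion\<close>

lemma RR_prob: "\<RR> \<subseteq> prob_measures H"
  by (auto simp: joint_completion_probs_def)

lemma restr_RR: "(\<lambda>R. restr_to_subalg R G) ` \<RR> = \<SS>"
  using ex1_extension unfolding joint_completion_probs_def by blast

lemma enlargement_H: "enlargement G \<PP>' H \<RR>"
  using subalgebra_H RR_prob equiv_sets_measure_iff[OF prob_S prob'] null_iff
  by (simp add: enlargement_def restr_RR)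

lemma null_RR_iff:
  assumes N: "N \<in> sets G" shows "upper_prob \<RR> N = 0 \<longleftrightarrow> upper_prob \<PP>' N = 0"
proof -
  have "emeasure (restr_to_subalg R G) N = emeasure R N" if "R \<in> \<RR>" for R
    using that RR_prob N by (intro emeasure_restr_to_subalg subalgebra_prob) auto
  then have "upper_prob \<RR> N = 0 \<longleftrightarrow> upper_prob ((\<lambda>R. restr_to_subalg R G) ` \<RR>) N = 0"
    by (simp add: upper_prob_eq_0_iff)
  then show ?thesis using null_iff N by (simp add: restr_RR)
qed

lemma AE_of_qs:
  assumes qs: "qs G \<PP>' \<phi>" and Q: "Q \<in> \<SS>" shows "AE \<omega> in Q. \<phi> \<omega>"
proof -
  obtain N where "N \<in> sets G" "upper_prob \<PP>' N = 0" "\<forall>\<omega>\<in>space G - N. \<phi> \<omega>"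
    using qs unfolding qs_def by blast
  then have "qs G \<SS> \<phi>" using null_iff[of N] unfolding qs_def by blast
  then show ?thesis using Q by (rule qs_AE[OF prob_S])
qed

section \<open>Injectivity and surjectivity of the induced map\<close>

lemma inj_on_J: "inj_on (J_map H \<RR>) (elems (Linf G \<PP>'))"
proof (rule inj_onI)
  fix X Y assume XY: "X \<in> elems (Linf G \<PP>')" "Y \<in> elems (Linf G \<PP>')" "J_map H \<RR> X = J_map H \<RR> Y"
  obtain f where f: "f \<in> borel_measurable G" "X = qs_class G \<PP>' f" using Linf_elemE[OF prob' XY(1)] by metis
  obtain g where g: "g \<in> borel_measurable G" "Y = qs_class G \<PP>' g" using Linf_elemE[OF prob' XY(2)] by metis
  have H: "f \<in> borel_measurable H" "g \<in> borel_measurable H"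
    using f g subalgebra_H by (auto intro: measurable_from_subalg)
  have "qs_class H \<RR> f = qs_class H \<RR> g"
    using XY(3) f g by (simp add: J_map_qs_class[OF enlargement_H prob'])
  then have "qs H \<RR> (\<lambda>\<omega>. f \<omega> = g \<omega>)" using H by (simp add: qs_class_eq_iff[OF RR_prob])
  then have qs: "qs H \<RR> (\<lambda>\<omega>. \<omega> \<notin> {\<omega> \<in> space G. f \<omega> \<noteq> g \<omega>})" by (rule qs_mono) simp
  \<comment> \<open>Both representatives are \<open>G\<close>-measurable, so the set where they
    differ is an event of \<open>G\<close>, and on such events the two upper probabilities have the
    same null sets.\<close>
  define N where "N = {\<omega> \<in> space G. f \<omega> \<noteq> g \<omega>}"
  have N: "N \<in> sets G" using f g unfolding N_def by simp
  then have "N \<in> sets H" using subalgebra_H by (auto simp: subalgebra_def)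
  then have "qs G \<PP>' (\<lambda>\<omega>. \<omega> \<notin> N)"
    using qs N qs_notin_iff[OF RR_prob, of N] qs_notin_iff[OF prob', of N] null_RR_iff[of N]
    unfolding N_def[symmetric] by blast
  then have "qs G \<PP>' (\<lambda>\<omega>. f \<omega> = g \<omega>)" by (rule qs_mono) (auto simp: N_def)
  then show "X = Y" using f g by (simp add: qs_class_eq_iff[OF prob'])
qed

lemma surj_J:
  assumes dc: "dedekind_complete (Linf G \<PP>')" and X: "X \<in> elems (Linf H \<RR>)"
  shows "X \<in> J_map H \<RR> ` elems (Linf G \<PP>')"
proof -
  obtain f m where f: "f \<in> borel_measurable H" "m > 0" "\<And>\<omega>. \<bar>f \<omega>\<bar> \<le> m" "X = qs_class H \<RR> f"
    using Linf_elemE[OF RR_prob X] by metis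
  have "\<exists>N\<in>null_sets Q. \<forall>k\<in>borel_measurable G. (\<lambda>\<omega>. if \<omega> \<in> N then k \<omega> else f \<omega>) \<in> borel_measurable G"
    if Q: "Q \<in> \<SS>" for Q
  proof -
    have eq: "borel_measurable Q = borel_measurable G"
      using SS_memberD(2)[OF Q] by (intro measurable_cong_sets) auto
    have "f \<in> borel_measurable (completion Q)"
      using subalgebra_completion[OF Q] f(1) by (rule measurable_from_subalg)
    then show ?thesis unfolding eq[symmetric] by (rule completion_modification)
  qed
  then have "\<forall>Q. \<exists>N. Q \<in> \<SS> \<longrightarrow> N \<in> null_sets Q \<and>
      (\<forall>k\<in>borel_measurable G. (\<lambda>\<omega>. if \<omega> \<in> N then k \<omega> else f \<omega>) \<in> borel_measurable G)"
    by blast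
  from choice[OF this] obtain N where N: "\<And>Q. Q \<in> \<SS> \<Longrightarrow> N Q \<in> null_sets Q"
      "\<And>Q k. Q \<in> \<SS> \<Longrightarrow> k \<in> borel_measurable G \<Longrightarrow> (\<lambda>\<omega>. if \<omega> \<in> N Q then k \<omega> else f \<omega>) \<in> borel_measurable G"
    by blast
  define F where "F Q \<omega> = (if \<omega> \<in> N Q then - m else f \<omega>)" for Q \<omega>
  have F: "F Q \<in> borel_measurable G" if "Q \<in> \<SS>" for Q
    using N(2)[OF that, of "\<lambda>_. - m"] unfolding F_def by simp
  have F_le: "F Q \<omega> \<le> f \<omega>" "- m \<le> F Q \<omega>" "F Q \<omega> \<le> m" for Q \<omega>
    using f(3)[of \<omega>] f(2) by (auto simp: F_def)
  have F_abs: "\<bar>F Q \<omega>\<bar> \<le> m" for Q \<omega>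
    using F_le[of Q \<omega>] by linarith
  have N_AE: "AE \<omega> in Q. \<omega> \<notin> N Q" if "Q \<in> \<SS>" for Q
    using N(1)[OF that] by (rule AE_not_in)
  \<comment> \<open>The constant \<open>- m\<close> only serves to make the family nonempty when \<open>\<SS>\<close> is empty.\<close>
  define \<A> where "\<A> = insert (qs_class G \<PP>' (\<lambda>_. - m)) ((\<lambda>Q. qs_class G \<PP>' (F Q)) ` \<SS>)"
  have "\<exists>s. is_supremum (Linf G \<PP>') \<A> s"
  proof (rule dc[unfolded dedekind_complete_def, rule_format])
    show "\<A> \<subseteq> elems (Linf G \<PP>')"
      using F F_abs f(2) qs_class_in_Linf[OF prob', of "\<lambda>_. - m" m]
      by (auto simp: \<A>_def intro!: qs_class_in_Linf[OF prob'])
    show "\<A> \<noteq> {}" by (simp add: \<A>_def)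
    have "qs_class G \<PP>' (\<lambda>_. m) \<in> elems (Linf G \<PP>')"
      using f(2) by (intro qs_class_in_Linf[OF prob', where m = m]) auto
    moreover have "\<forall>a\<in>\<A>. vle (Linf G \<PP>') a (qs_class G \<PP>' (\<lambda>_. m))"
      using F F_le f(2) by (auto simp: \<A>_def vle_Linf_qs_class[OF prob'] intro!: qs_everywhere)
    ultimately show "\<exists>u\<in>elems (Linf G \<PP>'). \<forall>a\<in>\<A>. vle (Linf G \<PP>') a u" by blast
  qed
  then obtain s where s: "is_supremum (Linf G \<PP>') \<A> s" by blast
  then have sL: "s \<in> elems (Linf G \<PP>')" by (simp add: is_supremum_def)
  obtain h n where h: "h \<in> borel_measurable G" "\<And>\<omega>. \<bar>h \<omega>\<bar> \<le> n" "s = qs_class G \<PP>' h"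
    using Linf_elemE[OF prob' sL] by metis
  have h_ge: "qs G \<PP>' (\<lambda>\<omega>. F Q \<omega> \<le> h \<omega>)" if "Q \<in> \<SS>" for Q
    using s that F h by (auto simp: is_supremum_def \<A>_def vle_Linf_qs_class[OF prob'])
  have h_ge_m: "qs G \<PP>' (\<lambda>\<omega>. - m \<le> h \<omega>)"
    using s h by (auto simp: is_supremum_def \<A>_def vle_Linf_qs_class[OF prob'])
  have AE_eq: "AE \<omega> in Q. f \<omega> = h \<omega>" if Q: "Q \<in> \<SS>" for Q
  proof -
    \<comment> \<open>Still an upper bound of the family: on \<open>N Q\<close> it keeps
      \<open>h\<close>, and elsewhere it is \<open>f\<close>, which lies above every
      \<open>F Q'\<close> and above \<open>- m\<close>.\<close>
    define h' where "h' \<omega> = (if \<omega> \<in> N Q then h \<omega> else f \<omega>)" for \<omega>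
    have h': "h' \<in> borel_measurable G" unfolding h'_def using N(2)[OF Q h(1)] .
    have "\<bar>h' \<omega>\<bar> \<le> max m n" for \<omega>
      using f(3)[of \<omega>] h(2)[of \<omega>] by (auto simp: h'_def)
    then have "qs_class G \<PP>' h' \<in> elems (Linf G \<PP>')"
      using h' by (intro qs_class_in_Linf[OF prob'])
    moreover have "vle (Linf G \<PP>') a (qs_class G \<PP>' h')" if a: "a \<in> \<A>" for a
    proof -
      have f_ge: "- m \<le> f \<omega>" for \<omega> using f(3)[of \<omega>] by linarith
      have "qs G \<PP>' (\<lambda>\<omega>. - m \<le> h' \<omega>)"
        using h_ge_m by (rule qs_mono) (auto simp: h'_def f_ge)
      moreover have "qs G \<PP>' (\<lambda>\<omega>. F Q' \<omega> \<le> h' \<omega>)" if "Q' \<in> \<SS>" for Q'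
        using h_ge[OF that] by (rule qs_mono) (auto simp: h'_def F_le)
      ultimately show ?thesis
        using a F h' by (auto simp: \<A>_def vle_Linf_qs_class[OF prob'])
    qed
    ultimately have "vle (Linf G \<PP>') s (qs_class G \<PP>' h')"
      using s by (simp add: is_supremum_def)
    then have "qs G \<PP>' (\<lambda>\<omega>. h \<omega> \<le> h' \<omega>)"
      using h h' by (simp add: vle_Linf_qs_class[OF prob'])
    \<comment> \<open>Off \<open>N Q\<close> both \<open>F Q\<close> and \<open>h'\<close> coincide
      with \<open>f\<close>, so minimality and the upper bound property give
      \<open>f \<le> h \<le> f\<close>.\<close>
    from AE_of_qs[OF this Q] AE_of_qs[OF h_ge[OF Q] Q] N_AE[OF Q]
    show ?thesis by eventually_elim (auto simp: F_def h'_def)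
  qed
  have hH: "h \<in> borel_measurable H" using h subalgebra_H by (auto intro: measurable_from_subalg)
  \<comment> \<open>Only here do the separate exceptional sets merge: \<open>f\<close> and
    \<open>h\<close> are both \<open>H\<close>-measurable, so the set where they differ is one
    event, null under every \<open>R\<close>.\<close>
  have "qs H \<RR> (\<lambda>\<omega>. f \<omega> = h \<omega>)"
  proof (rule qsI_AE[OF RR_prob])
    show "{\<omega> \<in> space H. f \<omega> = h \<omega>} \<in> sets H" using f(1) hH by simp
    fix R assume R: "R \<in> \<RR>"
    then have "restr_to_subalg R G \<in> \<SS>" "subalgebra R G"
      using restr_RR RR_prob subalgebra_prob by auto
    then show "AE \<omega> in R. f \<omega> = h \<omega>" using AE_eq AE_restr_to_subalg by blast
  qed
  then have "X = J_map H \<RR> s"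
    using f hH h by (simp add: J_map_qs_class[OF enlargement_H prob'] qs_class_eq_iff[OF RR_prob])
  then show ?thesis using sL by blast
qed

lemma lattice_isomorphism_J:
  assumes "dedekind_complete (Linf G \<PP>')"
  shows "lattice_isomorphism (Linf G \<PP>') (Linf H \<RR>) (J_map H \<RR>)"
proof -
  have hom: "lattice_hom (Linf G \<PP>') (Linf H \<RR>) (J_map H \<RR>)"
    using J_map_lattice_hom[OF enlargement_H prob'] .
  then have "J_map H \<RR> ` elems (Linf G \<PP>') \<subseteq> elems (Linf H \<RR>)"
    by (simp add: lattice_hom_def)
  moreover have "elems (Linf H \<RR>) \<subseteq> J_map H \<RR> ` elems (Linf G \<PP>')"
    using surj_J[OF assms] by (rule subsetI)
  ultimately have "J_map H \<RR> ` elems (Linf G \<PP>') = elems (Linf H \<RR>)" by (rule subset_antisym)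
  with hom inj_on_J show ?thesis by (simp add: lattice_isomorphism_def bij_betw_def)
qed

end

text \<open>Extensions are set functions while alternatives consist of elements of
  \<open>'a measure\<close>; the equation for \<open>prob_ext\<close> ties the two together. Since
  \<open>joint_completion_probs\<close> is described by restriction, the unique existence of
  \<open>R\<close> is what justifies reading it as the set of extended measures.\<close>

theorem theoremC6:
  fixes M G :: "'a measure" and \<PP> \<PP>' :: "'a measure set"
  assumes "\<PP> \<subseteq> prob_measures M" and "\<PP> \<noteq> {}"
    and "class_S M \<PP>"
    and "completes_Linf M \<PP> G \<PP>'"
  shows "(\<forall>\<mu>\<in>sca_c M \<PP>. \<exists>!\<nu>. sca_extension M G \<PP>' \<mu> \<nu>) \<and>
    (\<forall>\<QQ>. supported_alternative M \<PP> \<QQ> \<longrightarrow>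
      (\<forall>Q\<in>\<QQ>. measure (prob_ext M G \<PP>' Q) = sca_ext M G \<PP>' (measure Q)) \<and>
      supported_alternative G \<PP>' (prob_ext M G \<PP>' ` \<QQ>)) \<and>
    (\<forall>\<QQ>. supported_alternative M \<PP> \<QQ> \<longrightarrow>
      (let \<QQ>' = prob_ext M G \<PP>' ` \<QQ>;
           H = joint_completion G \<QQ>';
           \<QQ>'' = joint_completion_probs G \<QQ>'
       in (\<forall>Q\<in>\<QQ>'. \<exists>!R. R \<in> prob_measures H \<and> restr_to_subalg R G = Q) \<and>
          enlargement G \<PP>' H \<QQ>'' \<and>
          lattice_isomorphism (Linf G \<PP>') (Linf H \<QQ>'') (J_map H \<QQ>'')))"
proof -
  interpret dense_enlargement M G \<PP> \<PP>'
    using completes_Linf_dense_enlargement[OF assms(1,4)] .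
  have dc: "dedekind_complete (Linf G \<PP>')"
    using assms(4) by (simp add: completes_Linf_def dedekind_completion_def)
  have alt: "measure (prob_ext M G \<PP>' Q) = sca_ext M G \<PP>' (measure Q)"
    if "supported_alternative M \<PP> \<QQ>" "Q \<in> \<QQ>" for Q \<QQ>
    using that by (intro prob_ext(2)) (auto simp: supported_alternative_def)
  have "joint_completion_enlargement G \<PP>' (prob_ext M G \<PP>' ` \<QQ>)"
    if "supported_alternative M \<PP> \<QQ>" for \<QQ>
  proof
    have alt': "supported_alternative G \<PP>' (prob_ext M G \<PP>' ` \<QQ>)"
      using that by (rule supported_alternative_prob_ext)
    then show S: "prob_ext M G \<PP>' ` \<QQ> \<subseteq> prob_measures G" by (simp add: supported_alternative_def)
    show "\<PP>' \<subseteq> prob_measures G" by (rule prob')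
    show "upper_prob (prob_ext M G \<PP>' ` \<QQ>) N = 0 \<longleftrightarrow> upper_prob \<PP>' N = 0" if "N \<in> sets G" for N
      using alt' that equiv_sets_measure_iff[OF S prob'] by (simp add: supported_alternative_def)
  qed
  note joint = joint_completion_enlargement.ex1_extension[OF this]
    joint_completion_enlargement.enlargement_H[OF this]
    joint_completion_enlargement.lattice_isomorphism_J[OF this dc]
  show ?thesis
    unfolding Let_def
    by (intro conjI ballI allI impI sca_extension_ex1 alt supported_alternative_prob_ext joint)
qed

end
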